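(* Let $X$ be a (nonempty) $T_{3.5}$ space, and let $\mathbf 0\in C_p(X)$ be the constant zero function. The following are equivalent. (a) Player II has a winning strategy in $\Omega FO(X)$. (b) Player II has a winning Markov strategy in $\Omega FO(X)$. (c) Player I has a winning strategy in $G_1(\Omega_X,\Omega_X)$. (d) $X$ is not $\Omega$-Rothberger, that is, player I has a winning predetermined strategy in $G_1(\Omega_X,\Omega_X)$. (e) Player I has a winning strategy in $G_1(\Omega_{C_p(X),\mathbf 0},\Omega_{C_p(X),\mathbf 0})$. (f) $C_p(X)$ does not have strong countable fan tightness, that is, player I has a winning predetermined strategy in $G_1(\Omega_{C_p(X),\mathbf 0},\Omega_{C_p(X),\mathbf 0})$. (g) Player I has a winning strategy in $G_1(\mathcal D_{C_p(X)},\Omega_{C_p(X),\mathbf 0})$. (h) $C_p(X)$ does not have strong countable dense fan tightness, that is, player I has a winning predetermined strategy in $G_1(\mathcal D_{C_p(X)},\Omega_{C_p(X),\mathbf 0})$. (i) Player II has a winning strategy in Gruenhage's clustering game on $C_p(X)$ at $\mathbf 0$. (j) Player II has a winning Markov strategy in Gruenhage's clustering game on $C_p(X)$ at $\mathbf 0$. (k) Player II has a winning strategy in $CL(C_p(X),\mathbf 0)$. (l) Player II has a winning Markov strategy in $CL(C_p(X),\mathbf 0)$. (m) Player II has a winning strategy in $CD(C_p(X))$. (n) Player II has a winning Markov strategy in $CD(C_p(X))$.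
   Context: Spaces are nonempty. $C_p(X)$ is the space of continuous functions $X\to\mathbb R$ with the topology of pointwise convergence; $T_{3.5}$ means completely regular and $T_1$. $\omega=\{0,1,2,\dots\}$. Collections. An $\omega$-cover of a space $X$ is an open cover $\mathcal U$ such that every finite $F\subseteq X$ is contained in some $U\in\mathcal U$; $\Omega_X$ is the collection of $\omega$-covers of $X$. For a space $Y$ and $y\in Y$, $\Omega_{Y,y}$ is the collection of $A\subseteq Y$ with $y\in\overline A$, and $\mathcal D_Y$ is the collection of dense subsets of $Y$. Selection principles and games. $S_1(\mathcal A,\mathcal B)$ states: for all $A_n\in\mathcal A$ ($n<\omega$) there are $b_n\in A_n$ with $\{b_n:n<\omega\}\in\mathcal B$. In the game $G_1(\mathcal A,\mathcal B)$, in each round $n<\omega$ player I chooses $A_n\in\mathcal A$, then player II chooses $b_n\in A_n$; II wins if $\{b_n:n<\omega\}\in\mathcal B$, otherwise I wins. $X$ is $\Omega$-Rothberger if $S_1(\Omega_X,\Omega_X)$ holds. A space $Y$ has strong countable fan tightness if $S_1(\Omega_{Y,y},\Omega_{Y,y})$ holds for every $y\in Y$, and strong countable dense fan tightness if $S_1(\mathcal D_Y,\Omega_{Y,y})$ holds for every $y\in Y$; since $C_p(X)$ is homogeneous, it suffices to consider $y=\mathbf 0$. Other games (all of length $\omega$; in round $n$ player I moves first, then player II). - $\Omega FO(X)$: I plays a finite set $F_n\subseteq X$, II plays an open set $U_n\supseteq F_n$. I wins if $\{U_n:n<\omega\}$ is an $\omega$-cover of $X$; otherwise II wins. - Gruenhage's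 clustering game on $Y$ at $y$: I plays an open set $U_n\ni y$, II plays a point $y_n\in U_n$. I wins if $y$ is a cluster point of the sequence $(y_n)_{n<\omega}$, i.e. every neighborhood of $y$ contains $y_n$ for infinitely many $n$; otherwise II wins. - $CL(Y,y)$: I plays a nonempty open set $U_n\subseteq Y$, II plays a point $y_n\in U_n$. I wins if $y\in\overline{\{y_n:n<\omega\}}$; otherwise II wins. - $CD(Y)$: same moves as $CL(Y,y)$, but II wins if $\{y_n:n<\omega\}$ is closed and discrete in $Y$; otherwise I wins. Strategies. A strategy for a player decides each move as a function of all previous moves of the opponent (perfect information). A Markov strategy for II is a function $\sigma$ of only the most recent move of I and the round number. A predetermined strategy for I is a function of only the round number. A strategy is winning if the player using it wins against every legal sequence of moves of the opponent. *)

theory Defs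
  imports "HOL-Analysis.Analysis"
begin

section \<open>Games of length omega\<close>

text \<open>
  In each round player I chooses an element of \<open>moves G\<close> and player II answers a move \<open>a\<close> with an
  element of \<open>replies G a\<close>.  The outcome depends only on the sequence of answers of II;
  II wins exactly when I does not.
\<close>

record ('a, 'b) game =
  moves :: "'a set"
  replies :: "'a \<Rightarrow> 'b set"
  I_wins :: "(nat \<Rightarrow> 'b) \<Rightarrow> bool"

text \<open>
  A strategy for I is applied to the list of all earlier answers of II, so the move in round \<open>n\<close>
  is its value at a list of length \<open>n\<close>.  A strategy for II is applied to the nonempty list
  of all moves of I made so far, including that of the current round (the last entry).
  A winning strategy must in particular produce legal moves in every position it can reach.
\<close>

definition winning_strategy_I :: "('a, 'b) game \<Rightarrow> ('b list \<Rightarrow> 'a) \<Rightarrow> bool" where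
  "winning_strategy_I G \<sigma> \<longleftrightarrow>
    (\<forall>bs. (\<forall>i < length bs. bs ! i \<in> replies G (\<sigma> (take i bs))) \<longrightarrow> \<sigma> bs \<in> moves G) \<and>
    (\<forall>b. (\<forall>n. b n \<in> replies G (\<sigma> (map b [0..<n]))) \<longrightarrow> I_wins G b)"

definition winning_strategy_II :: "('a, 'b) game \<Rightarrow> ('a list \<Rightarrow> 'b) \<Rightarrow> bool" where
  "winning_strategy_II G \<tau> \<longleftrightarrow>
    (\<forall>as. as \<noteq> [] \<longrightarrow> set as \<subseteq> moves G \<longrightarrow> \<tau> as \<in> replies G (last as)) \<and>
    (\<forall>a. (\<forall>n. a n \<in> moves G) \<longrightarrow> \<not> I_wins G (\<lambda>n. \<tau> (map a [0..<Suc n])))"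

definition I_has_winning_strategy :: "('a, 'b) game \<Rightarrow> bool" where
  "I_has_winning_strategy G \<longleftrightarrow> (\<exists>\<sigma>. winning_strategy_I G \<sigma>)"

definition I_has_winning_predetermined_strategy :: "('a, 'b) game \<Rightarrow> bool" where
  "I_has_winning_predetermined_strategy G \<longleftrightarrow>
    (\<exists>\<sigma>. winning_strategy_I G (\<lambda>bs. \<sigma> (length bs)))"

definition II_has_winning_strategy :: "('a, 'b) game \<Rightarrow> bool" where
  "II_has_winning_strategy G \<longleftrightarrow> (\<exists>\<tau>. winning_strategy_II G \<tau>)"

text \<open>Rounds are numbered from \<open>0\<close>, whence \<open>length as - 1\<close>.\<close>

definition II_has_winning_Markov_strategy :: "('a, 'b) game \<Rightarrow> bool" where
  "II_has_winning_Markov_strategy G \<longleftrightarrow>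
    (\<exists>\<tau>. winning_strategy_II G (\<lambda>as. \<tau> (last as) (length as - 1)))"


section \<open>Selection principles and collections\<close>

definition S1 :: "'b set set \<Rightarrow> 'b set set \<Rightarrow> bool" where
  "S1 \<A> \<B> \<longleftrightarrow>
    (\<forall>A :: nat \<Rightarrow> 'b set. (\<forall>n. A n \<in> \<A>) \<longrightarrow> (\<exists>b. (\<forall>n. b n \<in> A n) \<and> range b \<in> \<B>))"

definition G1 :: "'b set set \<Rightarrow> 'b set set \<Rightarrow> ('b set, 'b) game" where
  "G1 \<A> \<B> = \<lparr>moves = \<A>, replies = (\<lambda>A. A), I_wins = (\<lambda>b. range b \<notin> \<B>)\<rparr>"

text \<open>As a trivial member, \<open>topspace X\<close> itself may belong to an omega-cover of \<open>X\<close>.\<close>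

definition omega_covers :: "'a topology \<Rightarrow> 'a set set set" where
  "omega_covers X = {\<U>. (\<forall>U \<in> \<U>. openin X U) \<and> \<Union>\<U> = topspace X \<and>
     (\<forall>F. finite F \<longrightarrow> F \<subseteq> topspace X \<longrightarrow> (\<exists>U \<in> \<U>. F \<subseteq> U))}"

definition clustering_sets :: "'a topology \<Rightarrow> 'a \<Rightarrow> 'a set set" where
  "clustering_sets Y y = {A. A \<subseteq> topspace Y \<and> y \<in> Y closure_of A}"

definition dense_sets :: "'a topology \<Rightarrow> 'a set set" where
  "dense_sets Y = {D. D \<subseteq> topspace Y \<and> Y closure_of D = topspace Y}"

definition Omega_Rothberger :: "'a topology \<Rightarrow> bool" where
  "Omega_Rothberger X \<longleftrightarrow> S1 (omega_covers X) (omega_covers X)"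

definition strong_countable_fan_tightness :: "'a topology \<Rightarrow> bool" where
  "strong_countable_fan_tightness Y \<longleftrightarrow>
    (\<forall>y \<in> topspace Y. S1 (clustering_sets Y y) (clustering_sets Y y))"

definition strong_countable_dense_fan_tightness :: "'a topology \<Rightarrow> bool" where
  "strong_countable_dense_fan_tightness Y \<longleftrightarrow>
    (\<forall>y \<in> topspace Y. S1 (dense_sets Y) (clustering_sets Y y))"


section \<open>Topological games\<close>

definition Omega_FO :: "'a topology \<Rightarrow> ('a set, 'a set) game" where
  "Omega_FO X =
    \<lparr>moves = {F. finite F \<and> F \<subseteq> topspace X},
     replies = (\<lambda>F. {U. openin X U \<and> F \<subseteq> U}),
     I_wins = (\<lambda>U. range U \<in> omega_covers X)\<rparr>"

definition Gruenhage_clustering :: "'a topology \<Rightarrow> 'a \<Rightarrow> ('a set, 'a) game" where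
  "Gruenhage_clustering Y y =
    \<lparr>moves = {U. openin Y U \<and> y \<in> U},
     replies = (\<lambda>U. U),
     I_wins = (\<lambda>s. \<forall>V. openin Y V \<and> y \<in> V \<longrightarrow> infinite {n. s n \<in> V})\<rparr>"

definition CL :: "'a topology \<Rightarrow> 'a \<Rightarrow> ('a set, 'a) game" where
  "CL Y y =
    \<lparr>moves = {U. openin Y U \<and> U \<noteq> {}},
     replies = (\<lambda>U. U),
     I_wins = (\<lambda>s. y \<in> Y closure_of (range s))\<rparr>"

definition CD :: "'a topology \<Rightarrow> ('a set, 'a) game" where
  "CD Y =
    \<lparr>moves = {U. openin Y U \<and> U \<noteq> {}},
     replies = (\<lambda>U. U),
     I_wins = (\<lambda>s. \<not> (closedin Y (range s) \<and>
                      subtopology Y (range s) = discrete_topology (range s)))\<rparr>"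


section \<open>The function space\<close>

text \<open>
  Points of a product topology are extensional functions, i.e. they take the value \<open>undefined\<close>
  outside the index set \<open>topspace X\<close>; hence the restriction in the zero function.
\<close>

definition Cp :: "'a topology \<Rightarrow> ('a \<Rightarrow> real) topology" where
  "Cp X = subtopology (product_topology (\<lambda>_. euclideanreal) (topspace X))
            {f. continuous_map X euclideanreal f}"

definition Cp_zero :: "'a topology \<Rightarrow> 'a \<Rightarrow> real" where
  "Cp_zero X = (\<lambda>x \<in> topspace X. 0)"

lemma topspace_Cp:
  "topspace (Cp X) = {f \<in> extensional (topspace X). continuous_map X euclideanreal f}"
  by (auto simp: Cp_def PiE_def)

lemma Cp_zero_in_Cp: "Cp_zero X \<in> topspace (Cp X)"
proof -
  have "continuous_map X euclideanreal (Cp_zero X)"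
    by (rule continuous_map_eq[of _ _ "\<lambda>_. 0"]) (auto simp: Cp_zero_def)
  then show ?thesis
    by (auto simp: topspace_Cp Cp_zero_def)
qed


definition all_equivalent :: "bool list \<Rightarrow> bool" where
  "all_equivalent Ps \<longleftrightarrow> (\<forall>P \<in> set Ps. \<forall>Q \<in> set Ps. P \<longleftrightarrow> Q)"

end

theory Submission
  imports Defs
begin

text \<open>
  All games translate into each other, except that one has to pass from arbitrary strategies to
  those that see only the last move and the round number.  This passage is the deep part.

  The translations form a circle.  A strategy of II in \<open>Omega_FO X\<close> gives one in \<open>CD (Cp X)\<close>,
  because an open set of functions restricts them only on a finite set \<open>F\<close>, and complete
  regularity lets a function equal the round number off any open set containing \<open>F\<close>
  (\<open>II_CD_if_Omega_FO\<close>).  Closed discrete answers that avoid \<open>y\<close> do not accumulate at \<open>y\<close>, which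
  leads to \<open>CL (Cp X) y\<close> (\<open>II_CL_if_CD\<close>).  This game is dual to the selection game from dense sets,
  and a dense set clusters at every point.  The selection game from sets clustering at \<open>y\<close> is in
  turn dual to a game that is harder for II than Gruenhage's game, and a strategy in
  Gruenhage's game is turned back into one in \<open>Omega_FO X\<close> by looking at the sets where the
  functions played are close to \<open>y\<close> (\<open>II_Omega_FO_if_Gruenhage\<close>).  Duality means that a strategy of
  I in a selection game tells II how to answer in a topological game, and conversely
  (\<open>II_wins_dual_game\<close>, \<open>I_wins_dual_game\<close>).  Every step looks at one round at a time, so the circle
  also holds for Markov strategies of II; the dual notion, a predetermined strategy of I, is
  the failure of the selection principle.  Since the clustering games are treated at
  an arbitrary point \<open>y\<close>, the failure of a tightness property at any point enters the same circle.

  Finally \<open>Omega_FO X\<close> is dual to the selection game on omega-covers, and the two circles are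
  joined by showing that I has no winning strategy there if the selection principle holds.  An
  omega-cover of \<open>X\<close> is an open cover of a space whose points are the finite subsets of
  \<open>X\<close>, so this follows from Pawlikowski's theorem on the Rothberger game of an arbitrary space
  (\<open>Pawlikowski\<close>).  Its proof has two stages.  Hurewicz's argument first finds finitely many
  candidate answers in each round, regardless of what II chose among the earlier candidates,
  such that every point is covered in infinitely many rounds (\<open>ex_bound_infinitely_often\<close>).
  The selection principle, applied to intersections of candidates from many different rounds,
  then picks one candidate in each round (\<open>ex_covering_branch\<close>).
\<close>

section \<open>Transferring strategies between games\<close>

lemma Markov_strategy_replies:
  assumes "winning_strategy_II G (\<lambda>as. \<tau> (last as) (length as - 1))" "a \<in> moves G"
  shows "\<tau> a n \<in> replies G a"
proof -
  \<comment> \<open>The move \<open>a\<close> can come up in any round \<open>n\<close>, for instance when I repeats it.\<close>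
  have "replicate (Suc n) a \<noteq> []" "set (replicate (Suc n) a) \<subseteq> moves G"
    using assms(2) by auto
  then have "\<tau> (last (replicate (Suc n) a)) (length (replicate (Suc n) a) - 1)
      \<in> replies G (last (replicate (Suc n) a))"
    using assms(1) unfolding winning_strategy_II_def by metis
  then show ?thesis
    by (simp del: replicate_Suc add: last_replicate)
qed

lemma Markov_strategy_wins:
  assumes "winning_strategy_II G (\<lambda>as. \<tau> (last as) (length as - 1))" "\<And>n. a n \<in> moves G"
  shows "\<not> I_wins G (\<lambda>n. \<tau> (a n) n)"
proof -
  have "\<not> I_wins G (\<lambda>n. \<tau> (last (map a [0..<Suc n])) (length (map a [0..<Suc n]) - 1))"
    using assms unfolding winning_strategy_II_def by (elim conjE allE[of _ a]) simp
  then show ?thesis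
    by simp
qed

lemma II_has_winning_strategy_if_Markov:
  "II_has_winning_Markov_strategy G \<Longrightarrow> II_has_winning_strategy G"
  by (auto simp: II_has_winning_Markov_strategy_def II_has_winning_strategy_def)

text \<open>
  If the moves of I in \<open>H\<close> can be turned, round by round, into moves in \<open>G\<close>, and the replies
  of II in \<open>G\<close> back into replies in \<open>H\<close>, then II simulates a play of \<open>G\<close> while playing \<open>H\<close>.
  Since the translation looks at one round only, Markov strategies are carried to Markov
  strategies.
\<close>

lemma II_strategy_transfer:
  fixes t :: "nat \<Rightarrow> 'a \<Rightarrow> 'c" and r :: "nat \<Rightarrow> 'a \<Rightarrow> 'd \<Rightarrow> 'b"
  assumes moves: "\<And>n a. a \<in> moves H \<Longrightarrow> t n a \<in> moves G"
    and replies: "\<And>n a b. a \<in> moves H \<Longrightarrow> b \<in> replies G (t n a) \<Longrightarrow> r n a b \<in> replies H a"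
    and wins: "\<And>a b. (\<And>n. a n \<in> moves H) \<Longrightarrow> (\<And>n. b n \<in> replies G (t n (a n))) \<Longrightarrow>
                 I_wins H (\<lambda>n. r n (a n) (b n)) \<Longrightarrow> I_wins G b"
  shows II_winning_strategy_transfer: "II_has_winning_strategy G \<Longrightarrow> II_has_winning_strategy H"
    and II_Markov_strategy_transfer:
      "II_has_winning_Markov_strategy G \<Longrightarrow> II_has_winning_Markov_strategy H"
proof -
  assume "II_has_winning_strategy G"
  then obtain \<tau> where \<tau>: "winning_strategy_II G \<tau>"
    by (auto simp: II_has_winning_strategy_def)
  define tr where "tr as = map (\<lambda>i. t i (as ! i)) [0..<length as]" for as
  define \<tau>' where "\<tau>' as = r (length as - 1) (last as) (\<tau> (tr as))" for as
  have legal: "\<tau> (tr as) \<in> replies G (t (length as - 1) (last as))"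
    if "as \<noteq> []" "set as \<subseteq> moves H" for as
  proof -
    have "set (tr as) \<subseteq> moves G" "tr as \<noteq> []"
      using that moves by (auto simp: tr_def subset_iff)
    moreover have "last (tr as) = t (length as - 1) (last as)"
      using that by (simp add: tr_def last_map last_conv_nth)
    ultimately show ?thesis
      using \<tau> unfolding winning_strategy_II_def by metis
  qed
  have "winning_strategy_II H \<tau>'"
    unfolding winning_strategy_II_def
  proof (intro conjI allI impI)
    fix as assume "as \<noteq> []" "set as \<subseteq> moves H"
    then show "\<tau>' as \<in> replies H (last as)"
      unfolding \<tau>'_def by (intro replies legal) (auto simp: subset_iff)
  next
    fix a :: "nat \<Rightarrow> 'a" assume a: "\<forall>n. a n \<in> moves H"
    define b where "b n = \<tau> (map (\<lambda>i. t i (a i)) [0..<Suc n])" for n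
    have tr: "tr (map a [0..<Suc n]) = map (\<lambda>i. t i (a i)) [0..<Suc n]" for n
      unfolding tr_def by (rule nth_equalityI) (simp_all del: upt_Suc)
    have "b n \<in> replies G (t n (a n))" for n
      using legal[of "map a [0..<Suc n]"] a unfolding tr b_def by (auto simp: image_subset_iff)
    moreover have "\<not> I_wins G b"
      using \<tau> a moves unfolding winning_strategy_II_def b_def by auto
    ultimately have "\<not> I_wins H (\<lambda>n. r n (a n) (b n))"
      using wins a by blast
    moreover have "\<tau>' (map a [0..<Suc n]) = r n (a n) (b n)" for n
      unfolding \<tau>'_def tr b_def by simp
    ultimately show "\<not> I_wins H (\<lambda>n. \<tau>' (map a [0..<Suc n]))"
      by simp
  qed
  then show "II_has_winning_strategy H"
    by (auto simp: II_has_winning_strategy_def)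
next
  assume "II_has_winning_Markov_strategy G"
  then obtain \<tau> where \<tau>: "winning_strategy_II G (\<lambda>as. \<tau> (last as) (length as - 1))"
    by (auto simp: II_has_winning_Markov_strategy_def)
  define \<tau>' where "\<tau>' a n = r n a (\<tau> (t n a) n)" for a n
  have "winning_strategy_II H (\<lambda>as. \<tau>' (last as) (length as - 1))"
    unfolding winning_strategy_II_def
  proof (intro conjI allI impI)
    fix as assume "as \<noteq> []" "set as \<subseteq> moves H"
    then show "\<tau>' (last as) (length as - 1) \<in> replies H (last as)"
      unfolding \<tau>'_def by (intro replies Markov_strategy_replies[OF \<tau>] moves) (auto simp: subset_iff)
  next
    fix a :: "nat \<Rightarrow> 'a" assume a: "\<forall>n. a n \<in> moves H"
    define b where "b n = \<tau> (t n (a n)) n" for n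
    have "b n \<in> replies G (t n (a n))" for n
      unfolding b_def using a by (intro Markov_strategy_replies[OF \<tau>] moves) auto
    moreover have "\<not> I_wins G b"
      using Markov_strategy_wins[OF \<tau>, of "\<lambda>n. t n (a n)"] a moves by (simp add: b_def[abs_def])
    ultimately have "\<not> I_wins H (\<lambda>n. r n (a n) (b n))"
      using wins a by blast
    then show "\<not> I_wins H (\<lambda>n. \<tau>' (last (map a [0..<Suc n])) (length (map a [0..<Suc n]) - 1))"
      by (simp add: \<tau>'_def b_def)
  qed
  then show "II_has_winning_Markov_strategy H"
    by (auto simp: II_has_winning_Markov_strategy_def)
qed

lemma not_S1_iff:
  "\<not> S1 \<A> \<B> \<longleftrightarrow>
    (\<exists>A :: nat \<Rightarrow> _ set. (\<forall>n. A n \<in> \<A>) \<and> (\<forall>b. (\<forall>n. b n \<in> A n) \<longrightarrow> range b \<notin> \<B>))"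
  by (simp only: S1_def not_all not_imp not_ex de_Morgan_conj)
    (simp only: imp_conv_disj not_all)

lemma winning_strategy_I_G1:
  "winning_strategy_I (G1 \<A> \<B>) \<sigma> \<longleftrightarrow>
    (\<forall>bs. (\<forall>i < length bs. bs ! i \<in> \<sigma> (take i bs)) \<longrightarrow> \<sigma> bs \<in> \<A>) \<and>
    (\<forall>b. (\<forall>n. b n \<in> \<sigma> (map b [0..<n])) \<longrightarrow> range b \<notin> \<B>)"
  by (simp add: winning_strategy_I_def G1_def)

lemma I_predetermined_if_not_S1:
  assumes "\<not> S1 \<A> \<B>"
  shows "I_has_winning_predetermined_strategy (G1 \<A> \<B>)"
proof -
  obtain A :: "nat \<Rightarrow> _ set" where A: "\<forall>n. A n \<in> \<A>" "\<forall>b. (\<forall>n. b n \<in> A n) \<longrightarrow> range b \<notin> \<B>"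
    using assms unfolding not_S1_iff by (elim exE conjE)
  have "winning_strategy_I (G1 \<A> \<B>) (\<lambda>bs. A (length bs))"
    unfolding winning_strategy_I_G1
  proof (intro conjI allI impI)
    show "A (length bs) \<in> \<A>" for bs
      by (simp add: A)
    fix b assume "\<forall>n. b n \<in> A (length (map b [0..<n]))"
    then show "range b \<notin> \<B>"
      using A(2) by simp
  qed
  then show ?thesis
    by (auto simp: I_has_winning_predetermined_strategy_def)
qed

text \<open>
  In a selection game a predetermined strategy is nothing but a sequence of members of \<open>\<A>\<close>
  from which no selection lies in \<open>\<B>\<close>.  Nonemptiness of the members matters: a strategy need
  not be legal in positions that cannot be reached.
\<close>

lemma I_predetermined_iff_not_S1:
  assumes "{} \<notin> \<A>"
  shows "I_has_winning_predetermined_strategy (G1 \<A> \<B>) \<longleftrightarrow> \<not> S1 \<A> \<B>"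
proof
  assume "I_has_winning_predetermined_strategy (G1 \<A> \<B>)"
  then obtain A :: "nat \<Rightarrow> _ set" where
    A: "\<And>bs. (\<forall>i < length bs. bs ! i \<in> A i) \<Longrightarrow> A (length bs) \<in> \<A>" and
    win: "\<And>b. (\<forall>n. b n \<in> A n) \<Longrightarrow> range b \<notin> \<B>"
    unfolding I_has_winning_predetermined_strategy_def winning_strategy_I_G1 by auto
  have "A n \<in> \<A>" for n
  proof (induction n rule: less_induct)
    case (less n)
    then have "\<forall>i<n. \<exists>b. b \<in> A i"
      using assms by (metis equals0I)
    then obtain b where "\<forall>i<n. b i \<in> A i"
      by metis
    then show ?case
      using A[of "map b [0..<n]"] by simp
  qed
  then show "\<not> S1 \<A> \<B>"
    using win unfolding S1_def by blast
qed (rule I_predetermined_if_not_S1)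

lemma I_has_winning_strategy_mono:
  assumes "I_has_winning_strategy (G1 \<A> \<B>)" "\<A> \<subseteq> \<A>'"
  shows "I_has_winning_strategy (G1 \<A>' \<B>)"
proof -
  obtain \<sigma> where \<sigma>: "winning_strategy_I (G1 \<A> \<B>) \<sigma>"
    using assms(1) unfolding I_has_winning_strategy_def by (elim exE)
  have "winning_strategy_I (G1 \<A>' \<B>) \<sigma>"
    unfolding winning_strategy_I_G1
    using \<sigma>[unfolded winning_strategy_I_G1] assms(2) by (metis subsetD)
  then show ?thesis
    by (auto simp: I_has_winning_strategy_def)
qed

section \<open>Duality between selection games and topological games\<close>

text \<open>
  The moves of I in \<open>H\<close> are tests that every member of \<open>\<A>\<close> passes: it contains a legal reply.
  So whatever I plays in the selection game can be answered by II in such a way that the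
  answer is a legal reply to a prescribed move of \<open>H\<close>.  The players thus exchange their
  roles: a strategy of I in the selection game tells II what to reply in \<open>H\<close>.
\<close>

lemma II_wins_dual_game:
  assumes hit: "\<And>A a. A \<in> \<A> \<Longrightarrow> a \<in> moves H \<Longrightarrow> A \<inter> replies H a \<noteq> {}"
    and wins: "\<And>a b. (\<And>n. a n \<in> moves H) \<Longrightarrow> (\<And>n. b n \<in> replies H (a n)) \<Longrightarrow>
                 I_wins H b \<Longrightarrow> range b \<in> \<B>"
  shows II_strategy_if_I_strategy_G1:
      "I_has_winning_strategy (G1 \<A> \<B>) \<Longrightarrow> II_has_winning_strategy H"
    and II_Markov_if_not_S1: "\<not> S1 \<A> \<B> \<Longrightarrow> II_has_winning_Markov_strategy H"
proof -
  define pick where "pick A a = (SOME b. b \<in> A \<inter> replies H a)" for A a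
  have pick: "pick A a \<in> A" "pick A a \<in> replies H a" if "A \<in> \<A>" "a \<in> moves H" for A a
    using someI_ex[of "\<lambda>b. b \<in> A \<inter> replies H a"] hit[OF that] unfolding pick_def by blast+
  {
    assume "I_has_winning_strategy (G1 \<A> \<B>)"
    then obtain \<sigma> where
      legal: "\<And>bs. (\<forall>i < length bs. bs ! i \<in> \<sigma> (take i bs)) \<Longrightarrow> \<sigma> bs \<in> \<A>" and
      win: "\<And>b. (\<forall>n. b n \<in> \<sigma> (map b [0..<n])) \<Longrightarrow> range b \<notin> \<B>"
      unfolding I_has_winning_strategy_def winning_strategy_I_G1 by metis
    define R where "R as = foldl (\<lambda>bs a. bs @ [pick (\<sigma> bs) a]) [] as" for as
    have R_simps: "R [] = []" "R (as @ [a]) = R as @ [pick (\<sigma> (R as)) a]" for as a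
      by (simp_all add: R_def)
    have R_legal: "length (R as) = length as \<and> (\<forall>i < length as. R as ! i \<in> \<sigma> (take i (R as)))"
      if "set as \<subseteq> moves H" for as
      using that
    proof (induction as rule: rev_induct)
      case Nil
      then show ?case by (simp add: R_simps)
    next
      case (snoc a as)
      then have IH: "length (R as) = length as" "\<forall>i < length as. R as ! i \<in> \<sigma> (take i (R as))"
        and "a \<in> moves H"
        by auto
      then have "\<sigma> (R as) \<in> \<A>"
        by (intro legal) auto
      then show ?case
        using IH pick(1)[OF _ \<open>a \<in> moves H\<close>] by (auto simp: R_simps nth_append less_Suc_eq)
    qed
    then have \<sigma>R: "\<sigma> (R as) \<in> \<A>" if "set as \<subseteq> moves H" for as
      using legal that by metis
    have "winning_strategy_II H (\<lambda>as. last (R as))"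
      unfolding winning_strategy_II_def
    proof (intro conjI allI impI)
      fix as assume "as \<noteq> []" "set as \<subseteq> moves H"
      moreover from this obtain as' a where "as = as' @ [a]"
        by (metis rev_exhaust)
      ultimately show "last (R as) \<in> replies H (last as)"
        using pick(2) \<sigma>R by (auto simp: R_simps)
    next
      fix a :: "nat \<Rightarrow> 'b" assume a: "\<forall>n. a n \<in> moves H"
      define b where "b n = pick (\<sigma> (R (map a [0..<n]))) (a n)" for n
      have Rb: "R (map a [0..<n]) = map b [0..<n]" for n
        by (induction n) (auto simp: R_simps b_def)
      have \<sigma>b: "\<sigma> (R (map a [0..<n])) \<in> \<A>" for n
        using a by (intro \<sigma>R) auto
      have "\<forall>n. b n \<in> \<sigma> (map b [0..<n])"
        using pick(1)[OF \<sigma>b] a by (auto simp: b_def Rb[symmetric])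
      then have "range b \<notin> \<B>"
        by (rule win)
      moreover have "b n \<in> replies H (a n)" for n
        using pick(2)[OF \<sigma>b] a by (auto simp: b_def)
      ultimately have "\<not> I_wins H b"
        using wins a by blast
      moreover have "last (R (map a [0..<Suc n])) = b n" for n
        by (simp add: Rb del: upt_Suc) simp
      ultimately show "\<not> I_wins H (\<lambda>n. last (R (map a [0..<Suc n])))"
        by simp
    qed
    then show "II_has_winning_strategy H"
      by (auto simp: II_has_winning_strategy_def)
  }
  assume "\<not> S1 \<A> \<B>"
  then obtain A :: "nat \<Rightarrow> _ set" where A: "\<forall>n. A n \<in> \<A>" "\<forall>b. (\<forall>n. b n \<in> A n) \<longrightarrow> range b \<notin> \<B>"
    unfolding not_S1_iff by (elim exE conjE)
  have "winning_strategy_II H (\<lambda>as. pick (A (length as - 1)) (last as))"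
    unfolding winning_strategy_II_def
  proof (intro conjI allI impI)
    fix as assume "as \<noteq> []" "set as \<subseteq> moves H"
    then show "pick (A (length as - 1)) (last as) \<in> replies H (last as)"
      by (intro pick(2)) (auto simp: subset_iff A)
  next
    fix a :: "nat \<Rightarrow> 'b" assume a: "\<forall>n. a n \<in> moves H"
    have "range (\<lambda>n. pick (A n) (a n)) \<notin> \<B>"
      using a A pick(1) by simp
    moreover have "pick (A n) (a n) \<in> replies H (a n)" for n
      using a A by (intro pick(2)) auto
    ultimately have "\<not> I_wins H (\<lambda>n. pick (A n) (a n))"
      using wins[of a "\<lambda>n. pick (A n) (a n)"] a by auto
    then show "\<not> I_wins H (\<lambda>n. pick (A (length (map a [0..<Suc n]) - 1)) (last (map a [0..<Suc n])))"
      by simp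
  qed
  then show "II_has_winning_Markov_strategy H"
    unfolding II_has_winning_Markov_strategy_def by (intro exI[of _ "\<lambda>a n. pick (A n) a"])
qed

text \<open>
  Conversely, if the values of any choice of replies form a member of \<open>\<A>\<close>, then I plays in the
  selection game the set of all answers that II's strategy in \<open>H\<close> could give next.  A reply
  in that set reveals a move of \<open>H\<close> which leads to it.
\<close>

lemma I_wins_dual_game:
  assumes choice: "\<And>\<phi>. (\<And>a. a \<in> moves H \<Longrightarrow> \<phi> a \<in> replies H a) \<Longrightarrow> \<phi> ` moves H \<in> \<A>"
    and wins: "\<And>b. range b \<in> \<B> \<Longrightarrow> I_wins H b"
  shows I_strategy_G1_if_II_strategy:
      "II_has_winning_strategy H \<Longrightarrow> I_has_winning_strategy (G1 \<A> \<B>)"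
    and not_S1_if_II_Markov: "II_has_winning_Markov_strategy H \<Longrightarrow> \<not> S1 \<A> \<B>"
proof -
  {
    assume "II_has_winning_strategy H"
    then obtain \<tau> where
      legal: "\<And>as. as \<noteq> [] \<Longrightarrow> set as \<subseteq> moves H \<Longrightarrow> \<tau> as \<in> replies H (last as)" and
      win: "\<And>a. (\<forall>n. a n \<in> moves H) \<Longrightarrow> \<not> I_wins H (\<lambda>n. \<tau> (map a [0..<Suc n]))"
      unfolding II_has_winning_strategy_def winning_strategy_II_def by metis
    define guess where "guess as b = (SOME a. a \<in> moves H \<and> \<tau> (as @ [a]) = b)" for as b
    define M where "M bs = foldl (\<lambda>as b. as @ [guess as b]) [] bs" for bs
    have M_simps: "M [] = []" "M (bs @ [b]) = M bs @ [guess (M bs) b]" for bs b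
      by (simp_all add: M_def)
    define \<sigma> where "\<sigma> bs = (\<lambda>a. \<tau> (M bs @ [a])) ` moves H" for bs
    have guess: "guess (M bs) b \<in> moves H \<and> \<tau> (M bs @ [guess (M bs) b]) = b" if "b \<in> \<sigma> bs" for bs b
      using someI_ex[of "\<lambda>a. a \<in> moves H \<and> \<tau> (M bs @ [a]) = b"] that
      unfolding guess_def \<sigma>_def by blast
    have M_moves: "set (M bs) \<subseteq> moves H" if "\<forall>i < length bs. bs ! i \<in> \<sigma> (take i bs)" for bs
      using that
    proof (induction bs rule: rev_induct)
      case (snoc b bs)
      have "b \<in> \<sigma> bs"
        using snoc.prems[rule_format, of "length bs"] by simp
      moreover have "\<forall>i < length bs. bs ! i \<in> \<sigma> (take i bs)"
        using snoc.prems by (auto simp: nth_append all_conj_distrib dest!: less_SucI split: if_splits)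
      ultimately show ?case
        using snoc.IH guess by (auto simp: M_simps)
    qed (simp add: M_simps)
    have "winning_strategy_I (G1 \<A> \<B>) \<sigma>"
      unfolding winning_strategy_I_G1
    proof (intro conjI allI impI)
      fix bs assume "\<forall>i < length bs. bs ! i \<in> \<sigma> (take i bs)"
      then have "set (M bs) \<subseteq> moves H"
        by (rule M_moves)
      then have "\<tau> (M bs @ [a]) \<in> replies H a" if "a \<in> moves H" for a
        using legal[of "M bs @ [a]"] that by simp
      then show "\<sigma> bs \<in> \<A>"
        unfolding \<sigma>_def by (rule choice)
    next
      fix b assume b: "\<forall>n. b n \<in> \<sigma> (map b [0..<n])"
      define a where "a n = guess (M (map b [0..<n])) (b n)" for n
      have Ma: "M (map b [0..<n]) = map a [0..<n]" for n
        by (induction n) (auto simp: M_simps a_def)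
      have "a n \<in> moves H" "\<tau> (map a [0..<Suc n]) = b n" for n
        using guess[OF b[rule_format, of n]] by (auto simp: a_def Ma[symmetric])
      then have "\<not> I_wins H b"
        using win[of a] by simp
      then show "range b \<notin> \<B>"
        using wins by blast
    qed
    then show "I_has_winning_strategy (G1 \<A> \<B>)"
      by (auto simp: I_has_winning_strategy_def)
  }
  assume "II_has_winning_Markov_strategy H"
  then obtain \<tau> where \<tau>: "winning_strategy_II H (\<lambda>as. \<tau> (last as) (length as - 1))"
    by (auto simp: II_has_winning_Markov_strategy_def)
  define A where "A n = (\<lambda>a. \<tau> a n) ` moves H" for n
  have "A n \<in> \<A>" for n
    unfolding A_def using Markov_strategy_replies[OF \<tau>] by (rule choice)
  moreover have "range b \<notin> \<B>" if b: "\<forall>n. b n \<in> A n" for b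
  proof -
    have "\<forall>n. \<exists>a. a \<in> moves H \<and> \<tau> a n = b n"
      using b unfolding A_def image_iff by metis
    then obtain a where "\<And>n. a n \<in> moves H" "\<And>n. \<tau> (a n) n = b n"
      by metis
    then have "\<not> I_wins H b"
      using Markov_strategy_wins[OF \<tau>, of a] by simp
    then show ?thesis
      using wins by blast
  qed
  ultimately show "\<not> S1 \<A> \<B>"
    unfolding S1_def by blast
qed

section \<open>The Rothberger game\<close>

definition open_covers :: "'a topology \<Rightarrow> 'a set set set" where
  "open_covers Y = {\<U>. (\<forall>U \<in> \<U>. openin Y U) \<and> \<Union>\<U> = topspace Y}"

text \<open>
  What a strategy of I in the Rothberger game becomes once its covers are thinned out to
  countable ones: positions are finite sequences of naturals, and \<open>U s k\<close> is the \<open>k\<close>-th set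
  offered to II at the position \<open>s\<close>.
\<close>

definition cover_tree :: "'a topology \<Rightarrow> (nat list \<Rightarrow> nat \<Rightarrow> 'a set) \<Rightarrow> bool" where
  "cover_tree Y U \<longleftrightarrow> (\<forall>s. range (U s) \<in> open_covers Y)"

definition bounded_nodes :: "(nat \<Rightarrow> nat) \<Rightarrow> nat \<Rightarrow> nat list set" where
  "bounded_nodes f n = {s. length s = n \<and> (\<forall>i<n. s ! i \<le> f i)}"

lemma finite_bounded_nodes: "finite (bounded_nodes f n)"
proof (rule finite_subset)
  show "bounded_nodes f n \<subseteq> {s. set s \<subseteq> (\<Union>i<n. {..f i}) \<and> length s = n}"
    by (fastforce simp: bounded_nodes_def in_set_conv_nth)
  show "finite {s. set s \<subseteq> (\<Union>i<n. {..f i}) \<and> length s = n}"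
    by (rule finite_lists_length_eq) auto
qed

text \<open>
  Hurewicz's argument for the Menger game.  Given a point \<open>x\<close>, a level \<open>m\<close> and a bound \<open>a\<close> on the
  entries of the nodes of level \<open>m\<close>, choose bounds \<open>\<phi> m\<close>, \<open>\<phi> (m + 1)\<close>, and so on: \<open>\<phi> n\<close> is
  so large that every node of level \<open>n\<close> with entries at most \<open>\<phi> (n - 1)\<close> (at most \<open>a\<close> if \<open>n = m\<close>)
  has a child with index at most \<open>\<phi> n\<close> whose set contains \<open>x\<close>.  Let \<open>f\<close> be nondecreasing with
  \<open>a = f m\<close>.  If \<open>f n \<ge> \<phi> n\<close> for some \<open>n \<ge> m\<close>, then at the first such \<open>n\<close> all nodes bounded by \<open>f\<close> have
  entries at most \<open>\<phi> (n - 1)\<close>, and \<open>f n\<close> is large enough for all of them.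

  The sets \<open>C m a d k\<close> below consist of the points for which \<open>\<phi> (m + d)\<close> can be chosen as \<open>k\<close>.
  They are open and cover the space as \<open>k\<close> varies, so the selection principle yields
  one \<open>f\<close> that reaches \<open>\<phi>\<close> somewhere for every point and every \<open>m\<close>; as \<open>m\<close> is arbitrary,
  the good levels of each point are infinite in number.
\<close>

lemma ex_bound_infinitely_often:
  assumes S1: "S1 (open_covers Y) (open_covers Y)" and tree: "cover_tree Y U"
  obtains f :: "nat \<Rightarrow> nat" where
    "\<And>x m. x \<in> topspace Y \<Longrightarrow> \<exists>n\<ge>m. \<forall>s \<in> bounded_nodes f n. \<exists>j \<le> f n. x \<in> U s j"
proof -
  have U_open: "openin Y (U s k)" and U_cover: "(\<Union>k. U s k) = topspace Y" for s k
    using tree by (auto simp: cover_tree_def open_covers_def)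
  define nodes where "nodes n a = {s. set s \<subseteq> {..a} \<and> length s = n}" for n a :: nat
  have nodes: "finite (nodes n a)" "nodes n a \<noteq> {}" for n a
    unfolding nodes_def using finite_lists_length_eq[of "{..a}" n]
    by (auto intro!: exI[of _ "replicate n 0"])
  define Q where "Q n a k = (\<Inter>s \<in> nodes n a. \<Union>j\<le>k. U s j)" for n a k
  have Q_open: "openin Y (Q n a k)" for n a k
    unfolding Q_def using nodes U_open by (intro openin_Inter) auto
  have Q_cover: "\<exists>k. x \<in> Q n a k" if "x \<in> topspace Y" for x n a
  proof -
    have "\<forall>s. \<exists>j. x \<in> U s j"
      using U_cover that by blast
    then obtain j where j: "\<And>s. x \<in> U s (j s)"
      by metis
    have "j s \<le> Max (j ` nodes n a)" if "s \<in> nodes n a" for s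
      using nodes that by (intro Max_ge) auto
    then have "x \<in> Q n a (Max (j ` nodes n a))"
      unfolding Q_def using j by blast
    then show ?thesis ..
  qed
  define C where "C m a d = rec_nat (Q m a) (\<lambda>d D k. \<Union>k'. D k' \<inter> Q (Suc (m + d)) k' k) d" for m a d
  have C_simps: "C m a 0 k = Q m a k" "C m a (Suc d) k = (\<Union>k'. C m a d k' \<inter> Q (Suc (m + d)) k' k)"
    for m a d k
    by (simp_all add: C_def)
  have C_open: "openin Y (C m a d k)" for m a d k
    by (induction d arbitrary: k) (auto simp: C_simps Q_open intro!: openin_Union openin_Int)
  have C_cover: "\<exists>k. x \<in> C m a d k" if x: "x \<in> topspace Y" for x m a d
  proof (induction d)
    case (Suc d)
    then obtain k' where "x \<in> C m a d k'" ..
    moreover obtain k where "x \<in> Q (Suc (m + d)) k' k"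
      using Q_cover[OF x] by blast
    ultimately show ?case
      unfolding C_simps by blast
  qed (simp add: C_simps Q_cover x)
  have "(\<Union>k. C m a d k) = topspace Y" for m a d
  proof
    show "(\<Union>k. C m a d k) \<subseteq> topspace Y"
      by (intro UN_least openin_subset C_open)
    show "topspace Y \<subseteq> (\<Union>k. C m a d k)"
      using C_cover by (simp add: subset_iff)
  qed
  then have "range (C m a d) \<in> open_covers Y" for m a d
    using C_open by (auto simp: open_covers_def)
  \<comment> \<open>Starting at depth \<open>a\<close> ensures \<open>m + d \<ge> a\<close>, so that \<open>f (m + d)\<close> below takes into account the
    selection made for \<open>m\<close> and \<open>a = f m\<close>.\<close>
  then have "\<exists>b. (\<forall>i. b i \<in> range (C m a (a + i))) \<and> range b \<in> open_covers Y" for m a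
    by (rule S1[unfolded S1_def, rule_format])
  then have "\<forall>m a. \<exists>b. (\<forall>i. b i \<in> range (C m a (a + i))) \<and> range b \<in> open_covers Y"
    by (intro allI)
  then obtain b where "\<forall>m a. (\<forall>i. b m a i \<in> range (C m a (a + i))) \<and> range (b m a) \<in> open_covers Y"
    unfolding choice_iff by (elim exE)
  then have b: "b m a i \<in> range (C m a (a + i))" "range (b m a) \<in> open_covers Y" for m a i
    by auto
  have "\<exists>k. b m a i = C m a (a + i) k" for m a i
    using b(1)[of m a i] by (rule rangeE) blast
  then obtain \<kappa> where \<kappa>: "\<And>m a i. b m a i = C m a (a + i) (\<kappa> m a i)"
    by metis
  \<comment> \<open>a sum rather than a maximum, since its monotonicity is immediate\<close>
  define f where "f n = (\<Sum>(m, a, i) \<in> {..n} \<times> {..n} \<times> {..n}. \<kappa> m a i)" for n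
  have mono_f: "f i \<le> f n" if "i \<le> n" for i n
    unfolding f_def using that by (intro sum_mono2) auto
  have \<kappa>_le_f: "\<kappa> m a i \<le> f n" if "m \<le> n" "a \<le> n" "i \<le> n" for m a i n
    unfolding f_def using that member_le_sum[of "(m, a, i)" "{..n} \<times> {..n} \<times> {..n}" "\<lambda>(m, a, i). \<kappa> m a i"]
    by auto
  have level: "\<forall>s \<in> bounded_nodes f n. \<exists>j \<le> f n. x \<in> U s j"
    if x: "x \<in> Q n a k" and f_le: "\<And>i. i < n \<Longrightarrow> f i \<le> a" and k: "k \<le> f n" for x n a k
  proof
    fix s assume "s \<in> bounded_nodes f n"
    then have "s \<in> nodes n a"
      using f_le by (fastforce simp: bounded_nodes_def nodes_def in_set_conv_nth)
    then obtain j where "j \<le> k" "x \<in> U s j"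
      using x unfolding Q_def by blast
    then show "\<exists>j \<le> f n. x \<in> U s j"
      using k order_trans by blast
  qed
  have crossing: "\<exists>n\<ge>m. \<forall>s \<in> bounded_nodes f n. \<exists>j \<le> f n. x \<in> U s j"
    if "x \<in> C m (f m) d k" "k \<le> f (m + d)" for x m d k
    using that
  proof (induction d arbitrary: k)
    case 0
    then show ?case
      using level[of x m "f m" k] mono_f by (auto simp: C_simps)
  next
    case (Suc d)
    then obtain k' where k': "x \<in> C m (f m) d k'" "x \<in> Q (Suc (m + d)) k' k"
      by (auto simp: C_simps)
    show ?case
    proof (cases "k' \<le> f (m + d)")
      case True
      then show ?thesis
        using Suc.IH k'(1) by blast
    next
      case False
      then have "f i \<le> k'" if "i < Suc (m + d)" for i
        using mono_f[of i "m + d"] that by simp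
      then show ?thesis
        using level[OF k'(2)] Suc.prems(2) by (intro exI[of _ "Suc (m + d)"]) auto
    qed
  qed
  show thesis
  proof
    fix x m assume "x \<in> topspace Y"
    then obtain i where "x \<in> b m (f m) i"
      using b(2)[of m "f m"] by (auto simp: open_covers_def)
    then show "\<exists>n\<ge>m. \<forall>s \<in> bounded_nodes f n. \<exists>j \<le> f n. x \<in> U s j"
      using crossing[of x m "f m + i" "\<kappa> m (f m) i"] \<kappa>_le_f[of m "m + (f m + i)" "f m" i]
      by (simp add: \<kappa>)
  qed
qed

lemma distinct_representatives:
  fixes D :: "nat \<Rightarrow> 'a set"
  assumes "\<And>k. card (D k) > k"
  obtains m where "\<And>k. m k \<in> D k" "inj m"
proof -
  have "\<exists>m. \<forall>k. m k \<in> D k \<and> m k \<notin> m ` {..<k}"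
  proof (rule dependent_wellorder_choice)
    fix m :: "nat \<Rightarrow> 'a" and k
    have "card (m ` {..<k}) < card (D k)"
      using card_image_le[of "{..<k}" m] assms[of k] by simp
    then have "\<not> D k \<subseteq> m ` {..<k}"
      using card_mono[of "m ` {..<k}" "D k"] by auto
    then show "\<exists>y. y \<in> D k \<and> y \<notin> m ` {..<k}"
      by blast
  qed auto
  then obtain m where m: "\<And>k. m k \<in> D k" "\<And>k. m k \<notin> m ` {..<k}"
    by blast
  have "inj m"
  proof (rule linorder_injI)
    show "m i \<noteq> m k" if "i < k" for i k
      using m(2)[of k] that by (metis imageI lessThan_iff)
  qed
  with m(1) show thesis
    by (rule that)
qed

text \<open>
  Pawlikowski's step from finitely many replies to a single one.  At level \<open>n\<close> a choice \<open>c\<close> of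
  one child for each bounded node determines an open set, the intersection of the chosen
  sets.  Every point lies in such intersections for infinitely many \<open>n\<close>, hence
  simultaneously at \<open>k + 1\<close> different levels for each \<open>k\<close>.  Selecting for the \<open>k\<close>-th cover a
  set of \<open>k + 1\<close> levels leaves room to assign to it a level \<open>\<mu> k\<close> not used before; the choices
  made at the levels \<open>\<mu> k\<close> can then be followed along one branch of the tree.
\<close>

lemma ex_covering_branch:
  assumes S1: "S1 (open_covers Y) (open_covers Y)" and tree: "cover_tree Y U"
  obtains g where "(\<Union>n. U (map g [0..<n]) (g n)) = topspace Y"
proof -
  obtain f :: "nat \<Rightarrow> nat" where
    f: "\<And>x m. x \<in> topspace Y \<Longrightarrow> \<exists>n\<ge>m. \<forall>s \<in> bounded_nodes f n. \<exists>j \<le> f n. x \<in> U s j"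
    using ex_bound_infinitely_often[OF assms] by metis
  have U_open: "openin Y (U s k)" for s k
    using tree by (auto simp: cover_tree_def open_covers_def)
  have nodes_ne: "bounded_nodes f n \<noteq> {}" for n
    by (auto simp: bounded_nodes_def intro!: exI[of _ "replicate n 0"])
  define choices where "choices = {c :: nat list \<Rightarrow> nat. \<forall>s. c s \<le> f (length s)}"
  define W where "W n c = (\<Inter>s \<in> bounded_nodes f n. U s (c s))" for n and c :: "nat list \<Rightarrow> nat"
  define V where "V k = {(\<Inter>n \<in> D. W n c) | D c. finite D \<and> card D = Suc k \<and> c \<in> choices}" for k
  have W_open: "openin Y (W n c)" for n c
    unfolding W_def using finite_bounded_nodes nodes_ne U_open by (intro openin_Inter) auto
  have "V k \<in> open_covers Y" for k
  proof -
    have V_open: "openin Y S" if S: "S \<in> V k" for S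
    proof -
      obtain D c where "S = (\<Inter>n \<in> D. W n c)" "finite D" "card D = Suc k"
        using S unfolding V_def by blast
      moreover have "D \<noteq> {}"
        using \<open>card D = Suc k\<close> by auto
      ultimately show ?thesis
        using W_open by (auto intro!: openin_Inter)
    qed
    moreover have "\<exists>S \<in> V k. x \<in> S" if x: "x \<in> topspace Y" for x
    proof -
      define N where "N = {n. \<forall>s \<in> bounded_nodes f n. \<exists>j \<le> f n. x \<in> U s j}"
      have "infinite N"
        using f[OF x] unfolding N_def infinite_nat_iff_unbounded_le by auto
      then obtain D where D: "D \<subseteq> N" "finite D" "card D = Suc k"
        using infinite_arbitrarily_large by metis
      define c where "c s = (if \<exists>j \<le> f (length s). x \<in> U s j
                              then SOME j. j \<le> f (length s) \<and> x \<in> U s j else 0)" for s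
      have c: "c s \<le> f (length s) \<and> x \<in> U s (c s)" if "\<exists>j \<le> f (length s). x \<in> U s j" for s
        using someI_ex[of "\<lambda>j. j \<le> f (length s) \<and> x \<in> U s j"] that by (auto simp: c_def)
      have "c \<in> choices"
        unfolding choices_def using c by (auto simp: c_def)
      moreover have "x \<in> W n c" if "n \<in> D" for n
        unfolding W_def
      proof
        fix s assume "s \<in> bounded_nodes f n"
        moreover from this have "length s = n"
          by (simp add: bounded_nodes_def)
        ultimately show "x \<in> U s (c s)"
          using c[of s] D(1) that by (auto simp: N_def)
      qed
      moreover from \<open>c \<in> choices\<close> have "(\<Inter>n \<in> D. W n c) \<in> V k"
        using D(2,3) unfolding V_def by auto
      ultimately show ?thesis
        by (intro bexI[of _ "\<Inter>n \<in> D. W n c"]) auto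
    qed
    ultimately show ?thesis
      using openin_subset by (fastforce simp: open_covers_def)
  qed
  then have "\<exists>S. (\<forall>k. S k \<in> V k) \<and> range S \<in> open_covers Y"
    by (rule S1[unfolded S1_def, rule_format])
  then obtain S where S: "\<forall>k. S k \<in> V k" "range S \<in> open_covers Y"
    by (elim exE conjE)
  have "\<forall>k. \<exists>D c. S k = (\<Inter>n \<in> D. W n c) \<and> card D = Suc k \<and> c \<in> choices"
    using S(1) unfolding V_def by blast
  then obtain D c where
    D: "\<And>k. S k = (\<Inter>n \<in> D k. W n (c k))" "\<And>k. card (D k) = Suc k" and c: "\<And>k. c k \<in> choices"
    by metis
  obtain \<mu> where \<mu>: "\<And>k. \<mu> k \<in> D k" "inj \<mu>"
    using distinct_representatives[of D] D(2) by auto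
  \<comment> \<open>At a level that represents no selection any child will do.\<close>
  define h where "h s = (if length s \<in> range \<mu> then c (inv \<mu> (length s)) s else 0)" for s
  define branch where "branch = rec_nat [] (\<lambda>_ s. s @ [h s])"
  define g where "g n = h (branch n)" for n
  have branch: "branch n = map g [0..<n]" for n
    by (induction n) (simp_all add: branch_def g_def)
  have h: "h s \<le> f (length s)" for s
    using c by (auto simp: h_def choices_def)
  have "g i \<le> f i" for i
    using h[of "branch i"] by (simp add: g_def branch)
  then have in_nodes: "map g [0..<n] \<in> bounded_nodes f n" for n
    by (auto simp: bounded_nodes_def)
  have "S k \<subseteq> U (map g [0..<\<mu> k]) (g (\<mu> k))" for k
  proof -
    have "g (\<mu> k) = c k (map g [0..<\<mu> k])"
      using \<mu>(2) by (simp add: g_def branch h_def)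
    then show ?thesis
      using D(1)[of k] \<mu>(1)[of k] in_nodes[of "\<mu> k"] by (auto simp: W_def)
  qed
  then have "S k \<subseteq> (\<Union>n. U (map g [0..<n]) (g n))" for k
    by (rule order_trans) (rule UN_upper, simp)
  then have "(\<Union>k. S k) \<subseteq> (\<Union>n. U (map g [0..<n]) (g n))"
    by (rule UN_least)
  moreover have "(\<Union>k. S k) = topspace Y"
    using S(2) by (simp add: open_covers_def)
  ultimately have "topspace Y \<subseteq> (\<Union>n. U (map g [0..<n]) (g n))"
    by simp
  moreover have "(\<Union>n. U (map g [0..<n]) (g n)) \<subseteq> topspace Y"
    using openin_subset[OF U_open] by (intro UN_least)
  ultimately show thesis
    by (intro that subset_antisym)
qed

text \<open>
  Selecting from a constant sequence of covers shows that every cover offered by I's strategy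
  has a countable subcover, so the strategy contains a tree of countable covers; a branch
  that covers the space is a play lost by I.
\<close>

theorem Pawlikowski:
  assumes S1: "S1 (open_covers Y) (open_covers Y)"
  shows "\<not> I_has_winning_strategy (G1 (open_covers Y) (open_covers Y))"
proof
  assume "I_has_winning_strategy (G1 (open_covers Y) (open_covers Y))"
  then obtain \<sigma> where
    legal: "\<And>bs. (\<forall>i < length bs. bs ! i \<in> \<sigma> (take i bs)) \<Longrightarrow> \<sigma> bs \<in> open_covers Y" and
    win: "\<And>b. (\<forall>n. b n \<in> \<sigma> (map b [0..<n])) \<Longrightarrow> range b \<notin> open_covers Y"
    unfolding I_has_winning_strategy_def winning_strategy_I_G1 by metis
  have "\<forall>\<C>. \<exists>e :: nat \<Rightarrow> 'a set. \<C> \<in> open_covers Y \<longrightarrow> (\<forall>k. e k \<in> \<C>) \<and> range e \<in> open_covers Y"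
    using S1[unfolded S1_def, rule_format, of "\<lambda>_. _"] by metis
  then obtain e :: "'a set set \<Rightarrow> nat \<Rightarrow> 'a set" where
    e: "\<And>\<C> k. \<C> \<in> open_covers Y \<Longrightarrow> e \<C> k \<in> \<C>" "\<And>\<C>. \<C> \<in> open_covers Y \<Longrightarrow> range (e \<C>) \<in> open_covers Y"
    by metis
  define pos where "pos s = foldl (\<lambda>bs k. bs @ [e (\<sigma> bs) k]) [] s" for s
  have pos_simps: "pos [] = []" "pos (s @ [k]) = pos s @ [e (\<sigma> (pos s)) k]" for s k
    by (simp_all add: pos_def)
  have "\<forall>i < length (pos s). pos s ! i \<in> \<sigma> (take i (pos s))" for s
  proof (induction s rule: rev_induct)
    case (snoc k s)
    then show ?case
      using e(1)[OF legal[OF snoc.IH]] by (auto simp: pos_simps nth_append less_Suc_eq)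
  qed (simp add: pos_simps)
  then have \<sigma>_pos: "\<sigma> (pos s) \<in> open_covers Y" for s
    by (rule legal)
  define U where "U s = e (\<sigma> (pos s))" for s
  have "cover_tree Y U"
    unfolding cover_tree_def U_def using e(2) \<sigma>_pos by blast
  then obtain g where g: "(\<Union>n. U (map g [0..<n]) (g n)) = topspace Y"
    using ex_covering_branch[OF S1] by metis
  define b where "b n = U (map g [0..<n]) (g n)" for n
  have pos_b: "pos (map g [0..<n]) = map b [0..<n]" for n
    by (induction n) (auto simp: pos_simps b_def U_def)
  have b: "b n \<in> \<sigma> (map b [0..<n])" for n
    using e(1)[OF \<sigma>_pos[of "map g [0..<n]"]] by (simp add: b_def U_def pos_b)
  then have "range b \<notin> open_covers Y"
    using win by blast
  moreover have "openin Y (b n)" for n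
    using \<sigma>_pos[of "map g [0..<n]"] b[of n] by (auto simp: open_covers_def pos_b)
  ultimately show False
    using g by (auto simp: open_covers_def b_def)
qed

section \<open>Omega-covers as covers of the space of finite subsets\<close>

text \<open>
  The finite subsets of \<open>X\<close>, with the sets \<open>Fpow U\<close> for open \<open>U\<close> as a base.  A family of
  open sets of \<open>X\<close> is an omega-cover exactly when the corresponding basic sets cover this
  space, so statements about omega-covers of \<open>X\<close> become statements about open covers.
\<close>

definition finite_subset_space :: "'a topology \<Rightarrow> 'a set topology" where
  "finite_subset_space X = topology (\<lambda>W. W \<subseteq> Fpow (topspace X) \<and>
     (\<forall>F \<in> W. \<exists>U. openin X U \<and> F \<subseteq> U \<and> Fpow U \<subseteq> W))"

lemma openin_finite_subset_space:
  "openin (finite_subset_space X) W \<longleftrightarrow>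
    W \<subseteq> Fpow (topspace X) \<and> (\<forall>F \<in> W. \<exists>U. openin X U \<and> F \<subseteq> U \<and> Fpow U \<subseteq> W)"
proof -
  have "istopology (\<lambda>W. W \<subseteq> Fpow (topspace X) \<and>
     (\<forall>F \<in> W. \<exists>U. openin X U \<and> F \<subseteq> U \<and> Fpow U \<subseteq> W))"
    unfolding istopology_def
  proof (intro conjI allI impI ballI)
    fix V W F
    assume V: "V \<subseteq> Fpow (topspace X) \<and> (\<forall>F \<in> V. \<exists>U. openin X U \<and> F \<subseteq> U \<and> Fpow U \<subseteq> V)"
      and W: "W \<subseteq> Fpow (topspace X) \<and> (\<forall>F \<in> W. \<exists>U. openin X U \<and> F \<subseteq> U \<and> Fpow U \<subseteq> W)"
    then show "V \<inter> W \<subseteq> Fpow (topspace X)"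
      by blast
    assume "F \<in> V \<inter> W"
    with V W obtain U U' where "openin X U" "F \<subseteq> U" "Fpow U \<subseteq> V"
      and "openin X U'" "F \<subseteq> U'" "Fpow U' \<subseteq> W"
      by (meson IntD1 IntD2)
    then show "\<exists>U. openin X U \<and> F \<subseteq> U \<and> Fpow U \<subseteq> V \<inter> W"
      by (intro exI[of _ "U \<inter> U'"]) (auto simp: Fpow_def)
  next
    fix \<W> assume \<W>: "\<forall>W \<in> \<W>. W \<subseteq> Fpow (topspace X) \<and>
      (\<forall>F \<in> W. \<exists>U. openin X U \<and> F \<subseteq> U \<and> Fpow U \<subseteq> W)"
    then show "\<Union>\<W> \<subseteq> Fpow (topspace X)"
      by blast
    fix F assume "F \<in> \<Union>\<W>"
    then obtain W where W: "W \<in> \<W>" "F \<in> W"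
      by blast
    with \<W> obtain U where "openin X U" "F \<subseteq> U" "Fpow U \<subseteq> W"
      by meson
    with W show "\<exists>U. openin X U \<and> F \<subseteq> U \<and> Fpow U \<subseteq> \<Union>\<W>"
      by (intro exI[of _ U]) blast
  qed
  then show ?thesis
    by (simp add: finite_subset_space_def topology_inverse')
qed

lemma openin_Fpow: "openin X U \<Longrightarrow> openin (finite_subset_space X) (Fpow U)"
  unfolding openin_finite_subset_space using openin_subset[of X U] Fpow_mono[of U "topspace X"]
  by (auto simp: Fpow_def intro!: exI[of _ U])

lemma topspace_finite_subset_space: "topspace (finite_subset_space X) = Fpow (topspace X)"
proof
  show "topspace (finite_subset_space X) \<subseteq> Fpow (topspace X)"
    using openin_topspace[of "finite_subset_space X"] unfolding openin_finite_subset_space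
    by (rule conjunct1)
  show "Fpow (topspace X) \<subseteq> topspace (finite_subset_space X)"
    by (intro openin_subset openin_Fpow) simp
qed

lemma omega_covers_iff:
  "\<U> \<in> omega_covers X \<longleftrightarrow>
    (\<forall>U \<in> \<U>. openin X U) \<and> (\<forall>F. finite F \<longrightarrow> F \<subseteq> topspace X \<longrightarrow> (\<exists>U \<in> \<U>. F \<subseteq> U))"
proof -
  have "\<Union>\<U> = topspace X"
    if "\<forall>U \<in> \<U>. openin X U" and cov: "\<forall>F. finite F \<longrightarrow> F \<subseteq> topspace X \<longrightarrow> (\<exists>U \<in> \<U>. F \<subseteq> U)"
  proof
    show "\<Union>\<U> \<subseteq> topspace X"
      using that(1) openin_subset by blast
    show "topspace X \<subseteq> \<Union>\<U>"
      using cov[rule_format, of "{_}"] by fastforce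
  qed
  then show ?thesis
    unfolding omega_covers_def by (auto simp only: mem_Collect_eq)
qed

lemma omega_cover_iff_Fpow_cover:
  assumes "\<forall>U \<in> \<U>. openin X U"
  shows "\<U> \<in> omega_covers X \<longleftrightarrow> Fpow ` \<U> \<in> open_covers (finite_subset_space X)"
proof -
  have "(\<Union>U \<in> \<U>. Fpow U) \<subseteq> Fpow (topspace X)"
    using assms by (intro UN_least Fpow_mono openin_subset) simp
  then have "Fpow ` \<U> \<in> open_covers (finite_subset_space X) \<longleftrightarrow> Fpow (topspace X) \<subseteq> (\<Union>U \<in> \<U>. Fpow U)"
    using assms by (auto simp: open_covers_def topspace_finite_subset_space intro!: openin_Fpow)
  also have "\<dots> \<longleftrightarrow> (\<forall>F. finite F \<longrightarrow> F \<subseteq> topspace X \<longrightarrow> (\<exists>U \<in> \<U>. F \<subseteq> U))"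
    by (auto simp: Fpow_def subset_iff)
  finally show ?thesis
    using assms by (simp add: omega_covers_iff)
qed

text \<open>
  The basic sets \<open>Fpow U\<close> contained in members of an open cover already form a cover, so it
  suffices to select from refinements by basic sets.
\<close>

lemma S1_open_covers_finite_subset_space:
  assumes "S1 (omega_covers X) (omega_covers X)"
  shows "S1 (open_covers (finite_subset_space X)) (open_covers (finite_subset_space X))"
  unfolding S1_def
proof (intro allI impI)
  fix A :: "nat \<Rightarrow> 'a set set set"
  assume A: "\<forall>n. A n \<in> open_covers (finite_subset_space X)"
  define \<U> where "\<U> n = {U. openin X U \<and> (\<exists>W \<in> A n. Fpow U \<subseteq> W)}" for n
  have "\<U> n \<in> omega_covers X" for n
    unfolding omega_covers_iff
  proof (intro conjI allI impI)
    fix F assume "finite F" "F \<subseteq> topspace X"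
    then have "F \<in> \<Union>(A n)"
      using A by (simp add: open_covers_def topspace_finite_subset_space Fpow_def)
    then obtain W where "W \<in> A n" "F \<in> W"
      by blast
    moreover have "openin (finite_subset_space X) W"
      using A \<open>W \<in> A n\<close> by (simp add: open_covers_def)
    then obtain U where "openin X U" "F \<subseteq> U" "Fpow U \<subseteq> W"
      using \<open>F \<in> W\<close> unfolding openin_finite_subset_space by blast
    ultimately show "\<exists>U \<in> \<U> n. F \<subseteq> U"
      unfolding \<U>_def by blast
  qed (simp add: \<U>_def)
  then have "\<exists>b. (\<forall>n. b n \<in> \<U> n) \<and> range b \<in> omega_covers X"
    by (rule assms[unfolded S1_def, rule_format])
  then obtain b where b: "\<forall>n. b n \<in> \<U> n" "range b \<in> omega_covers X"
    by (elim exE conjE)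
  then have "\<forall>n. \<exists>W. W \<in> A n \<and> Fpow (b n) \<subseteq> W"
    unfolding \<U>_def by blast
  then obtain W where W: "\<And>n. W n \<in> A n" "\<And>n. Fpow (b n) \<subseteq> W n"
    by metis
  have W_open: "openin (finite_subset_space X) (W n)" for n
    using A W(1) unfolding open_covers_def by blast
  have "(\<Union>n. W n) = topspace (finite_subset_space X)"
  proof
    show "(\<Union>n. W n) \<subseteq> topspace (finite_subset_space X)"
      by (intro UN_least openin_subset W_open)
    show "topspace (finite_subset_space X) \<subseteq> (\<Union>n. W n)"
    proof
      fix F assume "F \<in> topspace (finite_subset_space X)"
      then have F: "finite F" "F \<subseteq> topspace X"
        by (auto simp: topspace_finite_subset_space Fpow_def)
      then obtain n where "F \<subseteq> b n"
        using b(2) unfolding omega_covers_iff by blast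
      with F(1) show "F \<in> (\<Union>n. W n)"
        using W(2)[of n] by (auto simp: Fpow_def)
    qed
  qed
  then have "range W \<in> open_covers (finite_subset_space X)"
    using W_open by (simp add: open_covers_def)
  then show "\<exists>b. (\<forall>n. b n \<in> A n) \<and> range b \<in> open_covers (finite_subset_space X)"
    using W(1) by auto
qed

lemma Union_Fpow: "\<Union>(Fpow U) = U"
proof (intro equalityI subsetI)
  show "x \<in> U" if "x \<in> \<Union>(Fpow U)" for x
    using that by (auto simp: Fpow_def)
  show "x \<in> \<Union>(Fpow U)" if "x \<in> U" for x
    using that by (intro UnionI[of "{x}"]) (simp_all add: Fpow_def)
qed

text \<open>
  By the previous lemma, the union of a basic set is the open set it comes from.  So I can
  read off the corresponding play on \<open>X\<close> and follow the strategy there.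
\<close>

lemma I_wins_finite_subset_space:
  assumes "I_has_winning_strategy (G1 (omega_covers X) (omega_covers X))"
  shows "I_has_winning_strategy
    (G1 (open_covers (finite_subset_space X)) (open_covers (finite_subset_space X)))"
proof -
  obtain \<sigma> where \<sigma>: "winning_strategy_I (G1 (omega_covers X) (omega_covers X)) \<sigma>"
    using assms unfolding I_has_winning_strategy_def by (elim exE)
  have legal: "\<sigma> bs \<in> omega_covers X" if "\<forall>i < length bs. bs ! i \<in> \<sigma> (take i bs)" for bs
    using \<sigma> that by (simp add: winning_strategy_I_G1)
  have win: "range b \<notin> omega_covers X" if "\<forall>n. b n \<in> \<sigma> (map b [0..<n])" for b
    using \<sigma> that by (simp add: winning_strategy_I_G1)
  define \<sigma>' where "\<sigma>' bs = Fpow ` \<sigma> (map Union bs)" for bs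
  have "winning_strategy_I
    (G1 (open_covers (finite_subset_space X)) (open_covers (finite_subset_space X))) \<sigma>'"
    unfolding winning_strategy_I_G1
  proof (intro conjI allI impI)
    fix bs assume bs: "\<forall>i < length bs. bs ! i \<in> \<sigma>' (take i bs)"
    have "\<sigma> (map Union bs) \<in> omega_covers X"
    proof (intro legal allI impI)
      fix i assume "i < length (map Union bs)"
      then have "bs ! i \<in> Fpow ` \<sigma> (take i (map Union bs))"
        using bs by (simp add: \<sigma>'_def take_map)
      then show "map Union bs ! i \<in> \<sigma> (take i (map Union bs))"
        using \<open>i < length (map Union bs)\<close> by (auto simp: Union_Fpow)
    qed
    then show "\<sigma>' bs \<in> open_covers (finite_subset_space X)"
      using omega_cover_iff_Fpow_cover[of "\<sigma> (map Union bs)" X] by (simp add: \<sigma>'_def omega_covers_iff)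
  next
    fix b assume b: "\<forall>n. b n \<in> \<sigma>' (map b [0..<n])"
    define U where "U n = \<Union>(b n)" for n
    have "U n \<in> \<sigma> (map U [0..<n]) \<and> b n = Fpow (U n)" for n
    proof -
      have "b n \<in> Fpow ` \<sigma> (map U [0..<n])"
        using b[rule_format, of n] by (simp add: \<sigma>'_def U_def[abs_def] comp_def)
      then obtain V where V: "V \<in> \<sigma> (map U [0..<n])" "b n = Fpow V"
        by auto
      moreover have "U n = V"
        by (simp add: U_def V(2) Union_Fpow)
      ultimately show ?thesis
        by simp
    qed
    then have U: "U n \<in> \<sigma> (map U [0..<n])" and b_eq: "b n = Fpow (U n)" for n
      by simp_all
    have "\<sigma> (map U [0..<n]) \<in> omega_covers X" for n
      using U by (intro legal) (simp add: take_map)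
    then have "openin X (U n)" for n
      using U[of n] by (simp add: omega_covers_iff)
    then have "\<forall>V \<in> range U. openin X V"
      by simp
    moreover have "range U \<notin> omega_covers X"
      using U by (intro win) simp
    moreover have "range b = Fpow ` range U"
      using b_eq by auto
    ultimately show "range b \<notin> open_covers (finite_subset_space X)"
      using omega_cover_iff_Fpow_cover[of "range U" X] by simp
  qed
  then show ?thesis
    by (auto simp: I_has_winning_strategy_def)
qed

lemma omega_Pawlikowski:
  assumes "I_has_winning_strategy (G1 (omega_covers X) (omega_covers X))"
  shows "\<not> S1 (omega_covers X) (omega_covers X)"
  using Pawlikowski S1_open_covers_finite_subset_space I_wins_finite_subset_space[OF assms]
  by metis

section \<open>The topology of pointwise convergence\<close>

definition Cp_ball :: "'a topology \<Rightarrow> ('a \<Rightarrow> real) \<Rightarrow> 'a set \<Rightarrow> real \<Rightarrow> ('a \<Rightarrow> real) set" where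
  "Cp_ball X g F e = {f \<in> topspace (Cp X). \<forall>x \<in> F. \<bar>f x - g x\<bar> < e}"

lemma centre_in_Cp_ball: "g \<in> topspace (Cp X) \<Longrightarrow> e > 0 \<Longrightarrow> g \<in> Cp_ball X g F e"
  by (simp add: Cp_ball_def)

lemma openin_Cp_ball:
  assumes "finite F" "F \<subseteq> topspace X"
  shows "openin (Cp X) (Cp_ball X g F e)"
proof -
  have eval: "continuous_map (Cp X) euclideanreal (\<lambda>f. f x)" if "x \<in> F" for x
    unfolding Cp_def using that assms(2)
    by (intro continuous_map_from_subtopology continuous_map_product_projection) auto
  have "openin (Cp X) {f \<in> topspace (Cp X). f x \<in> {g x - e <..< g x + e}}" if "x \<in> F" for x
    using eval[OF that] by (rule openin_continuous_map_preimage) simp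
  then have "openin (Cp X) (topspace (Cp X) \<inter> (\<Inter>x \<in> F. {f \<in> topspace (Cp X). f x \<in> {g x - e <..< g x + e}}))"
    using assms(1) by (cases "F = {}") (auto intro!: openin_Int openin_Inter)
  also have "topspace (Cp X) \<inter> (\<Inter>x \<in> F. {f \<in> topspace (Cp X). f x \<in> {g x - e <..< g x + e}})
      = Cp_ball X g F e"
    by (fastforce simp: Cp_ball_def abs_less_iff)
  finally show ?thesis .
qed

lemma Cp_ball_base:
  assumes "openin (Cp X) U" "g \<in> U"
  obtains F e where "finite F" "F \<subseteq> topspace X" "e > 0" "Cp_ball X g F e \<subseteq> U"
proof -
  obtain T where T: "openin (product_topology (\<lambda>_. euclideanreal) (topspace X)) T"
    and U: "U = T \<inter> {f. continuous_map X euclideanreal f}"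
    using assms(1) unfolding Cp_def openin_subtopology by auto
  have "g \<in> T"
    using assms(2) U by simp
  then obtain V where V: "finite {i \<in> topspace X. V i \<noteq> UNIV}" "\<forall>i \<in> topspace X. open (V i)"
      "g \<in> Pi\<^sub>E (topspace X) V" "Pi\<^sub>E (topspace X) V \<subseteq> T"
    using T unfolding openin_product_topology_alt by (auto simp: open_openin[symmetric])
  define F where "F = {i \<in> topspace X. V i \<noteq> UNIV}"
  have "\<forall>i \<in> F. \<exists>e>0. \<forall>y. \<bar>y - g i\<bar> < e \<longrightarrow> y \<in> V i"
  proof
    fix i assume "i \<in> F"
    then have "open (V i)" "g i \<in> V i"
      using V(2,3) by (auto simp: F_def)
    then show "\<exists>e>0. \<forall>y. \<bar>y - g i\<bar> < e \<longrightarrow> y \<in> V i"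
      unfolding open_dist by (simp add: dist_real_def)
  qed
  then obtain e where e: "\<forall>i \<in> F. e i > 0 \<and> (\<forall>y. \<bar>y - g i\<bar> < e i \<longrightarrow> y \<in> V i)"
    by metis
  define d where "d = Min (insert 1 (e ` F))"
  have "finite F"
    using V(1) by (simp add: F_def)
  then have d: "d > 0" "\<And>i. i \<in> F \<Longrightarrow> d \<le> e i"
    using e by (auto simp: d_def)
  have "Cp_ball X g F d \<subseteq> U"
  proof
    fix f assume f: "f \<in> Cp_ball X g F d"
    have "f i \<in> V i" if "i \<in> topspace X" for i
    proof (cases "i \<in> F")
      case True
      then have "\<bar>f i - g i\<bar> < e i"
        using f d(2)[OF True] by (auto simp: Cp_ball_def)
      with e True show ?thesis
        by blast
    next
      case False
      with that show ?thesis
        by (simp add: F_def)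
    qed
    then have "f \<in> Pi\<^sub>E (topspace X) V"
      using f by (auto simp: Cp_ball_def topspace_Cp PiE_def)
    with V(4) show "f \<in> U"
      using f U by (auto simp: Cp_ball_def topspace_Cp)
  qed
  with \<open>finite F\<close> d(1) show thesis
    by (intro that[of F d]) (auto simp: F_def)
qed

lemma t1_space_Cp: "t1_space (Cp X)"
  unfolding Cp_def
  by (intro t1_space_subtopology) (simp add: t1_space_product_topology t1_space_euclidean)

lemma restrict_in_Cp:
  assumes "continuous_map X euclideanreal f"
  shows "restrict f (topspace X) \<in> topspace (Cp X)"
  using continuous_map_eq[OF assms, of "restrict f (topspace X)"] by (simp add: topspace_Cp)

text \<open>Moving a function by a small constant stays inside any given neighbourhood of it.\<close>

lemma Cp_no_isolated_points:
  assumes "topspace X \<noteq> {}" "openin (Cp X) U" "U \<noteq> {}"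
  shows "U - {y} \<noteq> {}"
proof
  assume "U - {y} = {}"
  with assms(3) have "y \<in> U" "U \<subseteq> {y}"
    by auto
  obtain F e where Fe: "finite F" "F \<subseteq> topspace X" "e > 0" "Cp_ball X y F e \<subseteq> U"
    using Cp_ball_base[OF assms(2) \<open>y \<in> U\<close>] by metis
  have "continuous_map X euclideanreal y"
    using openin_subset[OF assms(2)] \<open>y \<in> U\<close> by (auto simp: topspace_Cp)
  define f where "f = restrict (\<lambda>x. y x + e / 2) (topspace X)"
  have "f \<in> topspace (Cp X)"
    unfolding f_def using \<open>continuous_map X euclideanreal y\<close>
    by (intro restrict_in_Cp continuous_map_add) auto
  then have "f \<in> Cp_ball X y F e"
    using Fe(2,3) by (auto simp: Cp_ball_def f_def)
  then have "f = y"
    using Fe(4) \<open>U \<subseteq> {y}\<close> by auto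
  moreover obtain x where "x \<in> topspace X"
    using assms(1) by blast
  ultimately show False
    using Fe(3) by (auto simp: f_def fun_eq_iff dest!: spec[of _ x])
qed

lemma Cp_interpolation:
  assumes cr: "completely_regular_space X" and g: "g \<in> topspace (Cp X)"
    and F: "finite F" "F \<subseteq> V" and V: "openin X V"
  obtains f where "f \<in> topspace (Cp X)" "\<And>x. x \<in> F \<Longrightarrow> f x = g x"
    "\<And>x. x \<in> topspace X - V \<Longrightarrow> f x = c"
proof -
  have FX: "F \<subseteq> topspace X"
    using F(2) openin_subset[OF V] by blast
  then have "compactin X F" "closedin X (topspace X - V)" "disjnt F (topspace X - V)"
    using F V by (auto simp: finite_imp_compactin disjnt_iff)
  then obtain u where u: "continuous_map X euclideanreal u" "u ` F \<subseteq> {0}" "u ` (topspace X - V) \<subseteq> {1}"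
    using Urysohn_completely_regular_compact_closed_alt[OF cr] by metis
  have cont_g: "continuous_map X euclideanreal g"
    using g by (simp add: topspace_Cp)
  define f where "f = restrict (\<lambda>x. (1 - u x) * g x + u x * c) (topspace X)"
  show thesis
  proof
    show "f \<in> topspace (Cp X)"
      unfolding f_def using u(1) cont_g
      by (intro restrict_in_Cp continuous_map_add continuous_map_real_mult continuous_map_diff) auto
    show "f x = g x" if "x \<in> F" for x
      using that FX u(2) by (auto simp: f_def)
    show "f x = c" if "x \<in> topspace X - V" for x
      using that u(3) by (auto simp: f_def)
  qed
qed

lemma locally_finite_range_closed_discrete:
  assumes "t1_space Y" "range s \<subseteq> topspace Y"
    and loc: "\<And>y. y \<in> topspace Y \<Longrightarrow> \<exists>N. openin Y N \<and> y \<in> N \<and> finite {n :: nat. s n \<in> N}"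
  shows "closedin Y (range s)" "subtopology Y (range s) = discrete_topology (range s)"
proof -
  have "Y derived_set_of (range s) = {}"
  proof (rule equals0I)
    fix y assume "y \<in> Y derived_set_of (range s)"
    then have y: "y \<in> topspace Y" "\<And>U. y \<in> U \<and> openin Y U \<Longrightarrow> infinite (range s \<inter> U)"
      using assms(1) unfolding t1_space_derived_set_of_infinite_openin by auto
    obtain N where N: "openin Y N" "y \<in> N" "finite {n. s n \<in> N}"
      using loc[OF y(1)] by auto
    have "range s \<inter> N = s ` {n. s n \<in> N}"
      by auto
    then show False
      using y(2)[of N] N by simp
  qed
  then show "closedin Y (range s)" "subtopology Y (range s) = discrete_topology (range s)"
    using assms(2) by (simp_all add: closedin_contains_derived_set subtopology_eq_discrete_topology_eq)
qed

section \<open>Comparing the games on a space with those on its function space\<close>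

text \<open>
  In round \<open>n\<close> the finite set \<open>F\<close> is turned into the neighbourhood of \<open>y\<close> of radius
  \<open>1 / Suc n\<close> on \<open>F\<close>, and II's answer \<open>f\<close> into the open set where \<open>f\<close> is \<open>1 / Suc n\<close>-close
  to \<open>y\<close>.  For these sets to form an omega-cover is weaker than for the functions to cluster at
  \<open>y\<close>, since a finite set may be caught in an early round only.  Removing one point outside
  \<open>F\<close> from each answer prevents this: every finite set can then be enlarged by finitely many
  points so that the first \<open>m\<close> answers do not contain it.  On a finite \<open>X\<close> no such
  point need exist, but there II cannot win the clustering game: I forces convergence to
  \<open>y\<close> by replacing each \<open>F\<close> with the whole space, which is the purpose of \<open>fin\<close>.
\<close>

lemma
  assumes X: "t1_space X" and y: "y \<in> topspace (Cp X)"
  shows II_Omega_FO_if_Gruenhage: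
      "II_has_winning_strategy (Gruenhage_clustering (Cp X) y) \<Longrightarrow> II_has_winning_strategy (Omega_FO X)"
    and II_Markov_Omega_FO_if_Gruenhage:
      "II_has_winning_Markov_strategy (Gruenhage_clustering (Cp X) y) \<Longrightarrow>
        II_has_winning_Markov_strategy (Omega_FO X)"
proof -
  define fin where "fin F = (if finite (topspace X) then topspace X else F)" for F
  define pt where "pt F = (SOME p. p \<in> topspace X - F)" for F
  define rad where "rad n = 1 / real (Suc n)" for n
  define t where "t n F = Cp_ball X y (fin F) (rad n)" for n F
  define near where "near n f = {x \<in> topspace X. f x - y x \<in> {- rad n <..< rad n}}"
    for n and f :: "'a \<Rightarrow> real"
  define r where "r n F f = (if finite (topspace X) then near n f else near n f - {pt F})" for n F f
  have rad_pos: "rad n > 0" for n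
    by (simp add: rad_def)
  have rad_antimono: "rad n \<le> rad m" if "m \<le> n" for m n
    using that by (simp add: rad_def frac_le)
  have pt: "pt F \<in> topspace X - F" if "infinite (topspace X)" "finite F" for F
    using someI_ex[of "\<lambda>p. p \<in> topspace X - F"] that finite_subset[of "topspace X" F]
    unfolding pt_def by blast
  have near_open: "openin X (near n f)" if "f \<in> topspace (Cp X)" for n f
    unfolding near_def
  proof (rule openin_continuous_map_preimage)
    show "continuous_map X euclideanreal (\<lambda>x. f x - y x)"
      using that y by (intro continuous_map_diff) (simp_all add: topspace_Cp)
  qed simp
  have moves: "t n F \<in> moves (Gruenhage_clustering (Cp X) y)" if "F \<in> moves (Omega_FO X)" for n F
    using that y rad_pos
    by (auto simp: t_def fin_def Gruenhage_clustering_def Omega_FO_def intro!: openin_Cp_ball centre_in_Cp_ball)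
  have replies: "r n F f \<in> replies (Omega_FO X) F"
    if F: "F \<in> moves (Omega_FO X)" and f: "f \<in> replies (Gruenhage_clustering (Cp X) y) (t n F)" for n F f
  proof -
    have F: "finite F" "F \<subseteq> topspace X" and "f \<in> Cp_ball X y (fin F) (rad n)"
      using F f by (auto simp: t_def Gruenhage_clustering_def Omega_FO_def)
    have "F \<subseteq> fin F"
      using F(2) by (simp add: fin_def)
    then have "\<bar>f x - y x\<bar> < rad n" if "x \<in> F" for x
      using that \<open>f \<in> Cp_ball X y (fin F) (rad n)\<close> by (auto simp: Cp_ball_def)
    then have "f \<in> topspace (Cp X)" "F \<subseteq> near n f"
      using F(2) \<open>f \<in> Cp_ball X y (fin F) (rad n)\<close>
      by (fastforce simp: Cp_ball_def near_def abs_less_iff)+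
    moreover from this have "openin X (r n F f)"
      using X near_open[of f n] by (simp add: r_def t1_space_openin_delete_alt)
    ultimately show ?thesis
      using pt[of F] F by (auto simp: r_def Omega_FO_def)
  qed
  have wins: "I_wins (Gruenhage_clustering (Cp X) y) f"
    if F: "\<And>n. F n \<in> moves (Omega_FO X)"
      and f: "\<And>n. f n \<in> replies (Gruenhage_clustering (Cp X) y) (t n (F n))"
      and I: "I_wins (Omega_FO X) (\<lambda>n. r n (F n) (f n))" for F f
  proof -
    have fin_F: "finite (F n)" for n
      using F[of n] by (simp add: Omega_FO_def)
    have f_in: "f n \<in> Cp_ball X y (fin (F n)) (rad n)" for n
      using f[of n] by (simp add: Gruenhage_clustering_def t_def)
    have cover: "range (\<lambda>n. r n (F n) (f n)) \<in> omega_covers X"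
      using I by (simp add: Omega_FO_def)
    have "\<exists>n\<ge>m. f n \<in> N" if N: "openin (Cp X) N" "y \<in> N" for N m
    proof -
      obtain G e where G: "finite G" "G \<subseteq> topspace X" "e > 0" "Cp_ball X y G e \<subseteq> N"
        using Cp_ball_base[OF N] by metis
      obtain k where k: "rad k < e"
        using reals_Archimedean[OF G(3)] unfolding rad_def inverse_eq_divide by blast
      define M where "M = max m k"
      have "\<exists>n\<ge>M. \<forall>x \<in> G. \<bar>f n x - y x\<bar> < rad n"
      proof (cases "finite (topspace X)")
        case True
        then show ?thesis
          using f_in[of M] G(2) by (auto simp: Cp_ball_def fin_def)
      next
        case False
        define G' where "G' = G \<union> (\<lambda>n. pt (F n)) ` {..<M}"
        have "finite G'" "G' \<subseteq> topspace X"
          using G(1,2) pt[OF False fin_F] by (auto simp: G'_def)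
        then obtain n where n: "G' \<subseteq> r n (F n) (f n)"
          using cover unfolding omega_covers_iff by auto
        have "\<not> n < M"
        proof
          assume "n < M"
          then have "pt (F n) \<in> r n (F n) (f n)"
            using n by (auto simp: G'_def)
          with False show False
            by (simp add: r_def)
        qed
        moreover have "G \<subseteq> near n (f n)"
          using n False by (auto simp: G'_def r_def)
        ultimately show ?thesis
          by (intro exI[of _ n]) (auto simp: near_def abs_less_iff)
      qed
      then obtain n where n: "n \<ge> M" "\<forall>x \<in> G. \<bar>f n x - y x\<bar> < rad n"
        by blast
      then have "rad n < e"
        using k rad_antimono[of k n] by (simp add: M_def)
      with n have "f n \<in> Cp_ball X y G e"
        using f_in[of n] by (fastforce simp: Cp_ball_def)
      then show ?thesis
        using G(4) n(1) by (auto simp: M_def)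
    qed
    then show ?thesis
      by (auto simp: Gruenhage_clustering_def infinite_nat_iff_unbounded_le)
  qed
  show "II_has_winning_strategy (Gruenhage_clustering (Cp X) y) \<Longrightarrow> II_has_winning_strategy (Omega_FO X)"
    using moves replies wins by (rule II_winning_strategy_transfer)
  show "II_has_winning_Markov_strategy (Gruenhage_clustering (Cp X) y) \<Longrightarrow>
      II_has_winning_Markov_strategy (Omega_FO X)"
    using moves replies wins by (rule II_Markov_strategy_transfer)
qed

text \<open>
  An open set \<open>U\<close> restricts functions only on a finite set \<open>F\<close>.  When II answers \<open>F\<close> by
  \<open>V\<close> in the game on \<open>X\<close>, complete regularity provides a function in \<open>U\<close> with the constant value
  \<open>n\<close> off \<open>V\<close>.  If a finite set \<open>G\<close> is contained in none of II's answers, then each function chosen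
  takes the number of its round as a value on \<open>G\<close>, so these functions leave every set of
  functions bounded on \<open>G\<close>.
\<close>

lemma
  assumes cr: "completely_regular_space X"
  shows II_CD_if_Omega_FO:
      "II_has_winning_strategy (Omega_FO X) \<Longrightarrow> II_has_winning_strategy (CD (Cp X))"
    and II_Markov_CD_if_Omega_FO:
      "II_has_winning_Markov_strategy (Omega_FO X) \<Longrightarrow> II_has_winning_Markov_strategy (CD (Cp X))"
proof -
  have "\<forall>U. \<exists>F. U \<in> moves (CD (Cp X)) \<longrightarrow> finite F \<and> F \<subseteq> topspace X \<and>
      (\<exists>g e. g \<in> topspace (Cp X) \<and> e > 0 \<and> Cp_ball X g F e \<subseteq> U)"
  proof (intro allI)
    fix U
    show "\<exists>F. U \<in> moves (CD (Cp X)) \<longrightarrow> finite F \<and> F \<subseteq> topspace X \<and>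
      (\<exists>g e. g \<in> topspace (Cp X) \<and> e > 0 \<and> Cp_ball X g F e \<subseteq> U)"
    proof (cases "U \<in> moves (CD (Cp X))")
      case True
      then obtain g where U: "openin (Cp X) U" "g \<in> U"
        by (auto simp: CD_def)
      then show ?thesis
        using Cp_ball_base[OF U] openin_subset[OF U(1)] by (metis subsetD)
    qed simp
  qed
  then obtain supp where supp: "\<forall>U. U \<in> moves (CD (Cp X)) \<longrightarrow> finite (supp U) \<and> supp U \<subseteq> topspace X \<and>
      (\<exists>g e. g \<in> topspace (Cp X) \<and> e > 0 \<and> Cp_ball X g (supp U) e \<subseteq> U)"
    unfolding choice_iff by (elim exE)
  define r where "r n U V = (SOME f. f \<in> U \<and> (\<forall>x \<in> topspace X - V. f x = real n))" for n U V
  have r: "r n U V \<in> U \<and> (\<forall>x \<in> topspace X - V. r n U V x = real n)"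
    if U: "U \<in> moves (CD (Cp X))" and V: "openin X V" "supp U \<subseteq> V" for n U V
  proof -
    obtain g e where g: "g \<in> topspace (Cp X)" "e > 0" "Cp_ball X g (supp U) e \<subseteq> U" and "finite (supp U)"
      using supp U by metis
    obtain f where f: "f \<in> topspace (Cp X)" "\<And>x. x \<in> supp U \<Longrightarrow> f x = g x"
      "\<And>x. x \<in> topspace X - V \<Longrightarrow> f x = real n"
      using Cp_interpolation[OF cr g(1) \<open>finite (supp U)\<close> V(2,1)] by metis
    have "f \<in> Cp_ball X g (supp U) e"
      using f(1,2) g(2) by (simp add: Cp_ball_def)
    then have "f \<in> U \<and> (\<forall>x \<in> topspace X - V. f x = real n)"
      using f(3) g(3) by blast
    then show ?thesis
      unfolding r_def by (rule someI[of "\<lambda>f. f \<in> U \<and> (\<forall>x \<in> topspace X - V. f x = real n)"])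
  qed
  have moves: "supp U \<in> moves (Omega_FO X)" if "U \<in> moves (CD (Cp X))" for U and n :: nat
    using supp that by (simp add: Omega_FO_def)
  have replies: "r n U V \<in> replies (CD (Cp X)) U"
    if "U \<in> moves (CD (Cp X))" "V \<in> replies (Omega_FO X) (supp U)" for n U V
    using r[OF that(1), of V n] that(2) by (simp add: CD_def Omega_FO_def)
  have wins: "I_wins (Omega_FO X) V"
    if U: "\<And>n. U n \<in> moves (CD (Cp X))" and V: "\<And>n. V n \<in> replies (Omega_FO X) (supp (U n))"
      and I: "I_wins (CD (Cp X)) (\<lambda>n. r n (U n) (V n))" for U V
  proof (rule ccontr)
    define f where "f n = r n (U n) (V n)" for n
    have V: "openin X (V n)" "supp (U n) \<subseteq> V n" for n
      using V[of n] by (auto simp: Omega_FO_def)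
    have f: "f n \<in> U n" "\<And>x. x \<in> topspace X - V n \<Longrightarrow> f n x = real n" for n
      using r[OF U V, of n n] by (auto simp: f_def)
    have f_Cp: "f n \<in> topspace (Cp X)" for n
      using f(1)[of n] U[of n] openin_subset by (fastforce simp: CD_def)
    assume "\<not> I_wins (Omega_FO X) V"
    then have "range V \<notin> omega_covers X"
      by (simp add: Omega_FO_def)
    then obtain G where G: "finite G" "G \<subseteq> topspace X" "\<And>n. \<not> G \<subseteq> V n"
      using V(1) unfolding omega_covers_iff by auto
    have "\<exists>N. openin (Cp X) N \<and> h \<in> N \<and> finite {n. f n \<in> N}" if h: "h \<in> topspace (Cp X)" for h
    proof (intro exI conjI)
      show "openin (Cp X) (Cp_ball X h G 1)" "h \<in> Cp_ball X h G 1"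
        using G(1,2) h by (auto intro: openin_Cp_ball centre_in_Cp_ball)
      have "n \<in> (\<Union>x \<in> G. {..nat \<lceil>h x + 1\<rceil>})" if n: "f n \<in> Cp_ball X h G 1" for n
      proof -
        obtain x where x: "x \<in> G" "x \<notin> V n"
          using G(3) by blast
        then have "f n x = real n"
          using G(2) by (intro f(2)) auto
        moreover have "\<bar>f n x - h x\<bar> < 1"
          using n x(1) by (simp add: Cp_ball_def)
        ultimately have "\<bar>real n - h x\<bar> < 1"
          by simp
        then have "n \<le> nat \<lceil>h x + 1\<rceil>"
          by linarith
        with x show ?thesis
          by auto
      qed
      then have "{n. f n \<in> Cp_ball X h G 1} \<subseteq> (\<Union>x \<in> G. {..nat \<lceil>h x + 1\<rceil>})"
        by blast
      then show "finite {n. f n \<in> Cp_ball X h G 1}"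
        by (rule finite_subset) (simp add: G(1))
    qed
    then have "closedin (Cp X) (range f) \<and> subtopology (Cp X) (range f) = discrete_topology (range f)"
      using f_Cp by (intro conjI locally_finite_range_closed_discrete t1_space_Cp) auto
    moreover have "I_wins (CD (Cp X)) f"
      using I by (simp add: f_def[abs_def])
    ultimately show False
      by (simp add: CD_def)
  qed
  show "II_has_winning_strategy (Omega_FO X) \<Longrightarrow> II_has_winning_strategy (CD (Cp X))"
    using moves replies wins by (rule II_winning_strategy_transfer)
  show "II_has_winning_Markov_strategy (Omega_FO X) \<Longrightarrow> II_has_winning_Markov_strategy (CD (Cp X))"
    using moves replies wins by (rule II_Markov_strategy_transfer)
qed

text \<open>
  II avoids the point \<open>y\<close> itself, which is never isolated.  A closed set of answers that omits
  \<open>y\<close> does not have \<open>y\<close> in its closure.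
\<close>

lemma
  assumes X: "topspace X \<noteq> {}"
  shows II_CL_if_CD:
      "II_has_winning_strategy (CD (Cp X)) \<Longrightarrow> II_has_winning_strategy (CL (Cp X) y)"
    and II_Markov_CL_if_CD:
      "II_has_winning_Markov_strategy (CD (Cp X)) \<Longrightarrow> II_has_winning_Markov_strategy (CL (Cp X) y)"
proof -
  have moves: "U - {y} \<in> moves (CD (Cp X))" if "U \<in> moves (CL (Cp X) y)" for U and n :: nat
    using that t1_space_Cp[of X] Cp_no_isolated_points[OF X, of U y]
    unfolding CD_def CL_def t1_space_openin_delete_alt by simp
  have replies: "f \<in> replies (CL (Cp X) y) U"
    if "U \<in> moves (CL (Cp X) y)" "f \<in> replies (CD (Cp X)) (U - {y})" for n :: nat and U f
    using that(2) by (simp add: CD_def CL_def)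
  have wins: "I_wins (CD (Cp X)) f"
    if "\<And>n. U n \<in> moves (CL (Cp X) y)" and f: "\<And>n. f n \<in> replies (CD (Cp X)) (U n - {y})"
      and I: "I_wins (CL (Cp X) y) (\<lambda>n. f n)" for U f
  proof -
    have "y \<notin> range f"
      using f by (auto simp: CD_def)
    then have "\<not> closedin (Cp X) (range f)"
      using I closure_of_closedin by (fastforce simp: CL_def)
    then show ?thesis
      by (simp add: CD_def)
  qed
  show "II_has_winning_strategy (CD (Cp X)) \<Longrightarrow> II_has_winning_strategy (CL (Cp X) y)"
    using moves replies wins by (rule II_winning_strategy_transfer)
  show "II_has_winning_Markov_strategy (CD (Cp X)) \<Longrightarrow> II_has_winning_Markov_strategy (CL (Cp X) y)"
    using moves replies wins by (rule II_Markov_strategy_transfer)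
qed

section \<open>Instances of the duality\<close>

lemma
  shows empty_notin_omega_covers: "{} \<notin> omega_covers X"
    and empty_notin_clustering_sets: "{} \<notin> clustering_sets Y y"
    and empty_notin_dense_sets: "topspace Y \<noteq> {} \<Longrightarrow> {} \<notin> dense_sets Y"
  by (auto simp: omega_covers_iff clustering_sets_def dense_sets_def
      simp flip: null_topspace_iff_trivial)

lemma dense_sets_subset_clustering_sets: "y \<in> topspace Y \<Longrightarrow> dense_sets Y \<subseteq> clustering_sets Y y"
  by (auto simp: dense_sets_def clustering_sets_def)

lemma
  shows II_Omega_FO_iff_I_omega_covers:
      "II_has_winning_strategy (Omega_FO X) \<longleftrightarrow>
        I_has_winning_strategy (G1 (omega_covers X) (omega_covers X))"
    and II_Markov_Omega_FO_iff_not_S1_omega_covers: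
      "II_has_winning_Markov_strategy (Omega_FO X) \<longleftrightarrow> \<not> S1 (omega_covers X) (omega_covers X)"
proof -
  have hit: "A \<inter> replies (Omega_FO X) F \<noteq> {}"
    if "A \<in> omega_covers X" "F \<in> moves (Omega_FO X)" for A F
    using that by (fastforce simp: omega_covers_iff Omega_FO_def)
  have choice: "\<phi> ` moves (Omega_FO X) \<in> omega_covers X"
    if "\<And>F. F \<in> moves (Omega_FO X) \<Longrightarrow> \<phi> F \<in> replies (Omega_FO X) F" for \<phi>
    using that by (auto simp: omega_covers_iff Omega_FO_def)
  have wins_iff: "I_wins (Omega_FO X) b \<longleftrightarrow> range b \<in> omega_covers X" for b
    by (simp add: Omega_FO_def)
  note wins = wins_iff[THEN iffD1] wins_iff[THEN iffD2]
  show "II_has_winning_strategy (Omega_FO X) \<longleftrightarrow>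
      I_has_winning_strategy (G1 (omega_covers X) (omega_covers X))"
    using I_strategy_G1_if_II_strategy[OF choice wins(2)] II_strategy_if_I_strategy_G1[OF hit wins(1)]
    by (rule iffI)
  show "II_has_winning_Markov_strategy (Omega_FO X) \<longleftrightarrow> \<not> S1 (omega_covers X) (omega_covers X)"
    using not_S1_if_II_Markov[OF choice wins(2)] II_Markov_if_not_S1[OF hit wins(1)]
    by (rule iffI)
qed

text \<open>
  One answer chosen in each nonempty open set gives a dense set, so strategies of II in \<open>CL\<close>
  produce dense sets for I.
\<close>

lemma
  shows I_dense_sets_if_II_CL:
      "II_has_winning_strategy (CL Y y) \<Longrightarrow>
        I_has_winning_strategy (G1 (dense_sets Y) (clustering_sets Y y))"
    and not_S1_dense_sets_if_II_Markov_CL: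
      "II_has_winning_Markov_strategy (CL Y y) \<Longrightarrow> \<not> S1 (dense_sets Y) (clustering_sets Y y)"
proof -
  have choice: "\<phi> ` moves (CL Y y) \<in> dense_sets Y"
    if \<phi>: "\<And>U. U \<in> moves (CL Y y) \<Longrightarrow> \<phi> U \<in> replies (CL Y y) U" for \<phi>
  proof -
    have \<phi>_in: "\<phi> U \<in> U" if "openin Y U" "U \<noteq> {}" for U
      using \<phi>[of U] that by (simp add: CL_def)
    have "\<phi> ` moves (CL Y y) \<subseteq> topspace Y"
      using \<phi>_in openin_subset by (fastforce simp: CL_def)
    moreover have "Y closure_of (\<phi> ` moves (CL Y y)) = topspace Y"
      unfolding dense_intersects_open
    proof (intro allI impI)
      fix U assume "openin Y U \<and> U \<noteq> {}"
      then have "\<phi> U \<in> \<phi> ` moves (CL Y y) \<inter> U"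
        using \<phi>_in by (simp add: CL_def)
      then show "\<phi> ` moves (CL Y y) \<inter> U \<noteq> {}"
        by blast
    qed
    ultimately show ?thesis
      by (simp add: dense_sets_def)
  qed
  have wins: "I_wins (CL Y y) b" if "range b \<in> clustering_sets Y y" for b
    using that by (simp add: CL_def clustering_sets_def)
  show "II_has_winning_strategy (CL Y y) \<Longrightarrow>
      I_has_winning_strategy (G1 (dense_sets Y) (clustering_sets Y y))"
    using choice wins by (rule I_strategy_G1_if_II_strategy)
  show "II_has_winning_Markov_strategy (CL Y y) \<Longrightarrow> \<not> S1 (dense_sets Y) (clustering_sets Y y)"
    using choice wins by (rule not_S1_if_II_Markov)
qed

text \<open>
  The condition for I in the clustering game asks for infinitely many rounds near \<open>y\<close>, which
  is more than \<open>y\<close> being in the closure of the answers.  It therefore suits only this direction;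
  the way back leads through the game on \<open>X\<close>.
\<close>

lemma
  shows II_Gruenhage_if_I_clustering_sets:
      "I_has_winning_strategy (G1 (clustering_sets Y y) (clustering_sets Y y)) \<Longrightarrow>
        II_has_winning_strategy (Gruenhage_clustering Y y)"
    and II_Markov_Gruenhage_if_not_S1_clustering_sets:
      "\<not> S1 (clustering_sets Y y) (clustering_sets Y y) \<Longrightarrow>
        II_has_winning_Markov_strategy (Gruenhage_clustering Y y)"
proof -
  have hit: "A \<inter> replies (Gruenhage_clustering Y y) U \<noteq> {}"
    if "A \<in> clustering_sets Y y" "U \<in> moves (Gruenhage_clustering Y y)" for A U
    using that by (auto simp: clustering_sets_def Gruenhage_clustering_def in_closure_of)
  have wins: "range b \<in> clustering_sets Y y"
    if U: "\<And>n. U n \<in> moves (Gruenhage_clustering Y y)"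
      and b: "\<And>n. b n \<in> replies (Gruenhage_clustering Y y) (U n)"
      and I: "I_wins (Gruenhage_clustering Y y) b" for U b
  proof -
    have "range b \<subseteq> topspace Y"
      using U b openin_subset by (fastforce simp: Gruenhage_clustering_def)
    moreover have "y \<in> topspace Y"
      using U[of 0] openin_subset by (fastforce simp: Gruenhage_clustering_def)
    moreover have "\<exists>z. z \<in> range b \<and> z \<in> V" if "y \<in> V \<and> openin Y V" for V
    proof -
      have "infinite {n. b n \<in> V}"
        using I that by (simp add: Gruenhage_clustering_def)
      then have "{n. b n \<in> V} \<noteq> {}"
        by (rule infinite_imp_nonempty)
      then show ?thesis
        by blast
    qed
    ultimately show ?thesis
      by (simp add: clustering_sets_def in_closure_of)
  qed
  show "I_has_winning_strategy (G1 (clustering_sets Y y) (clustering_sets Y y)) \<Longrightarrow>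
      II_has_winning_strategy (Gruenhage_clustering Y y)"
    using hit wins by (rule II_strategy_if_I_strategy_G1)
  show "\<not> S1 (clustering_sets Y y) (clustering_sets Y y) \<Longrightarrow>
      II_has_winning_Markov_strategy (Gruenhage_clustering Y y)"
    using hit wins by (rule II_Markov_if_not_S1)
qed

section \<open>The equivalence\<close>

theorem theorem23:
  fixes X :: "'a topology"
  assumes "topspace X \<noteq> {}"
    and "completely_regular_space X" and "t1_space X"
  shows "all_equivalent
    [II_has_winning_strategy (Omega_FO X),
     II_has_winning_Markov_strategy (Omega_FO X),
     I_has_winning_strategy (G1 (omega_covers X) (omega_covers X)),
     \<not> Omega_Rothberger X,
     I_has_winning_predetermined_strategy (G1 (omega_covers X) (omega_covers X)),
     I_has_winning_strategy
       (G1 (clustering_sets (Cp X) (Cp_zero X)) (clustering_sets (Cp X) (Cp_zero X))),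
     \<not> strong_countable_fan_tightness (Cp X),
     I_has_winning_predetermined_strategy
       (G1 (clustering_sets (Cp X) (Cp_zero X)) (clustering_sets (Cp X) (Cp_zero X))),
     I_has_winning_strategy
       (G1 (dense_sets (Cp X)) (clustering_sets (Cp X) (Cp_zero X))),
     \<not> strong_countable_dense_fan_tightness (Cp X),
     I_has_winning_predetermined_strategy
       (G1 (dense_sets (Cp X)) (clustering_sets (Cp X) (Cp_zero X))),
     II_has_winning_strategy (Gruenhage_clustering (Cp X) (Cp_zero X)),
     II_has_winning_Markov_strategy (Gruenhage_clustering (Cp X) (Cp_zero X)),
     II_has_winning_strategy (CL (Cp X) (Cp_zero X)),
     II_has_winning_Markov_strategy (CL (Cp X) (Cp_zero X)),
     II_has_winning_strategy (CD (Cp X)),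
     II_has_winning_Markov_strategy (CD (Cp X))]"
proof -
  let ?Y = "Cp X" and ?z = "Cp_zero X"
  have z: "?z \<in> topspace ?Y"
    by (rule Cp_zero_in_Cp)
  note duality = II_Omega_FO_iff_I_omega_covers[of X] II_Markov_Omega_FO_iff_not_S1_omega_covers[of X]
  have mono: "S1 (clustering_sets ?Y y) \<B> \<Longrightarrow> S1 (dense_sets ?Y) \<B>" if "y \<in> topspace ?Y" for y \<B>
    using dense_sets_subset_clustering_sets[OF that] by (auto simp: S1_def subset_iff)

  \<comment> \<open>the circle of implications for strategies of full information\<close>
  have m: "II_has_winning_strategy (CD ?Y)" if "II_has_winning_strategy (Omega_FO X)"
    using II_CD_if_Omega_FO[OF assms(2)] that .
  have k: "II_has_winning_strategy (CL ?Y ?z)" if "II_has_winning_strategy (CD ?Y)"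
    using II_CL_if_CD[OF assms(1)] that .
  have g: "I_has_winning_strategy (G1 (dense_sets ?Y) (clustering_sets ?Y ?z))"
    if "II_has_winning_strategy (CL ?Y ?z)"
    using I_dense_sets_if_II_CL that .
  have e: "I_has_winning_strategy (G1 (clustering_sets ?Y ?z) (clustering_sets ?Y ?z))"
    if "I_has_winning_strategy (G1 (dense_sets ?Y) (clustering_sets ?Y ?z))"
    using I_has_winning_strategy_mono[OF that dense_sets_subset_clustering_sets[OF z]] .
  have i: "II_has_winning_strategy (Gruenhage_clustering ?Y ?z)"
    if "I_has_winning_strategy (G1 (clustering_sets ?Y ?z) (clustering_sets ?Y ?z))"
    using II_Gruenhage_if_I_clustering_sets that .
  have a: "II_has_winning_strategy (Omega_FO X)"
    if "II_has_winning_strategy (Gruenhage_clustering ?Y ?z)"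
    using II_Omega_FO_if_Gruenhage[OF assms(3) z] that .

  \<comment> \<open>the same circle for Markov and predetermined strategies\<close>
  have n: "II_has_winning_Markov_strategy (CD ?Y)" if "II_has_winning_Markov_strategy (Omega_FO X)"
    using II_Markov_CD_if_Omega_FO[OF assms(2)] that .
  have l: "II_has_winning_Markov_strategy (CL ?Y ?z)" if "II_has_winning_Markov_strategy (CD ?Y)"
    using II_Markov_CL_if_CD[OF assms(1)] that .
  have h: "\<not> S1 (dense_sets ?Y) (clustering_sets ?Y ?z)"
    if "II_has_winning_Markov_strategy (CL ?Y ?z)"
    using not_S1_dense_sets_if_II_Markov_CL that .
  have f: "\<not> S1 (clustering_sets ?Y ?z) (clustering_sets ?Y ?z)"
    if "\<not> S1 (dense_sets ?Y) (clustering_sets ?Y ?z)"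
    using mono[OF z] that by auto
  have j: "II_has_winning_Markov_strategy (Gruenhage_clustering ?Y ?z)"
    if "\<not> S1 (clustering_sets ?Y ?z) (clustering_sets ?Y ?z)"
    using II_Markov_Gruenhage_if_not_S1_clustering_sets that .
  have b: "II_has_winning_Markov_strategy (Omega_FO X)"
    if "II_has_winning_Markov_strategy (Gruenhage_clustering ?Y y)" "y \<in> topspace ?Y" for y
    using II_Markov_Omega_FO_if_Gruenhage[OF assms(3) that(2,1)] .

  \<comment> \<open>the two tightness properties quantify over all points, but failing at any point suffices\<close>
  have fan: "II_has_winning_Markov_strategy (Omega_FO X)"
    if "y \<in> topspace ?Y" "\<not> S1 (clustering_sets ?Y y) (clustering_sets ?Y y)" for y
    using b II_Markov_Gruenhage_if_not_S1_clustering_sets that by metis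
  have scft: "\<not> strong_countable_fan_tightness ?Y \<longleftrightarrow> II_has_winning_Markov_strategy (Omega_FO X)"
    using fan z f h l n unfolding strong_countable_fan_tightness_def by metis
  have scdft: "\<not> strong_countable_dense_fan_tightness ?Y \<longleftrightarrow> II_has_winning_Markov_strategy (Omega_FO X)"
    using fan mono z h l n unfolding strong_countable_dense_fan_tightness_def by metis

  \<comment> \<open>Pawlikowski's theorem joins the two circles\<close>
  have paw: "II_has_winning_Markov_strategy (Omega_FO X)" if "II_has_winning_strategy (Omega_FO X)"
    using that duality omega_Pawlikowski by metis
  define P where "P \<longleftrightarrow> II_has_winning_Markov_strategy (Omega_FO X)"
  have full: "II_has_winning_strategy (Omega_FO X) \<longleftrightarrow> P"
    "II_has_winning_strategy (CD ?Y) \<longleftrightarrow> P" "II_has_winning_strategy (CL ?Y ?z) \<longleftrightarrow> P"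
    "I_has_winning_strategy (G1 (dense_sets ?Y) (clustering_sets ?Y ?z)) \<longleftrightarrow> P"
    "I_has_winning_strategy (G1 (clustering_sets ?Y ?z) (clustering_sets ?Y ?z)) \<longleftrightarrow> P"
    "II_has_winning_strategy (Gruenhage_clustering ?Y ?z) \<longleftrightarrow> P"
    using paw II_has_winning_strategy_if_Markov m k g e i a unfolding P_def by metis+
  have Markov: "II_has_winning_Markov_strategy (Omega_FO X) \<longleftrightarrow> P"
    "II_has_winning_Markov_strategy (CD ?Y) \<longleftrightarrow> P" "II_has_winning_Markov_strategy (CL ?Y ?z) \<longleftrightarrow> P"
    "S1 (dense_sets ?Y) (clustering_sets ?Y ?z) \<longleftrightarrow> \<not> P"
    "S1 (clustering_sets ?Y ?z) (clustering_sets ?Y ?z) \<longleftrightarrow> \<not> P"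
    "II_has_winning_Markov_strategy (Gruenhage_clustering ?Y ?z) \<longleftrightarrow> P"
    using n l h f j b[OF _ z] unfolding P_def by metis+
  have Omega: "I_has_winning_strategy (G1 (omega_covers X) (omega_covers X)) \<longleftrightarrow> P"
    "S1 (omega_covers X) (omega_covers X) \<longleftrightarrow> \<not> P"
    using duality full(1) unfolding P_def by metis+
  have "topspace ?Y \<noteq> {}"
    using z by blast
  note predetermined = I_predetermined_iff_not_S1[OF empty_notin_omega_covers]
    I_predetermined_iff_not_S1[OF empty_notin_clustering_sets]
    I_predetermined_iff_not_S1[OF empty_notin_dense_sets[OF \<open>topspace ?Y \<noteq> {}\<close>]]
  show ?thesis
    unfolding all_equivalent_def Omega_Rothberger_def predetermined full Markov Omega
      scft[folded P_def] scdft[folded P_def]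
    by simp
qed

end
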